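(* For every unsolvable separation problem $P$ there exists an unsolvable separation problem $Q$ that is strictly smaller than $P$ with respect to weak (Muchnik) reducibility, i.e., $Q\le_w P$ and not $P\le_w Q$.
   Context: For a pair $\langle A,B\rangle$ of disjoint computably enumerable subsets of $\mathbb{N}$, its separation problem (in the sense of Medvedev) is the mass problem consisting of the characteristic functions of all separators of $\langle A,B\rangle$, where $D$ is a separator if $A\subset D$ and $B\cap D=\varnothing$. The separation problem is unsolvable if it contains no computable function, i.e., $\langle A,B\rangle$ has no computable separator. For mass problems $P,Q$ (sets of functions $\mathbb{N}\to\mathbb{N}$), $Q\le_w P$ (weak or Muchnik reducibility) means that for every $g\in P$ there is $f\in Q$ with $f$ Turing reducible to $g$. *)

theory Defs
  imports Main
begin

datatype recf =
    Zero
  | Succ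
  | Proj nat
  | Comp recf "recf list"
  | Prim recf recf
  | Mn recf
  | Oracle

inductive eval :: "(nat \<Rightarrow> nat) \<Rightarrow> recf \<Rightarrow> nat list \<Rightarrow> nat \<Rightarrow> bool" for g where
  eval_Zero: "eval g Zero xs 0"
| eval_Succ: "eval g Succ xs (Suc (case xs of [] \<Rightarrow> 0 | x # _ \<Rightarrow> x))"
| eval_Proj: "i < length xs \<Longrightarrow> eval g (Proj i) xs (xs ! i)"
| eval_Comp: "list_all2 (\<lambda>h y. eval g h xs y) hs ys \<Longrightarrow> eval g f ys y \<Longrightarrow> eval g (Comp f hs) xs y"
| eval_Prim0: "eval g f xs y \<Longrightarrow> eval g (Prim f h) (0 # xs) y"
| eval_PrimS: "eval g (Prim f h) (n # xs) r \<Longrightarrow> eval g h (n # r # xs) y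
                 \<Longrightarrow> eval g (Prim f h) (Suc n # xs) y"
| eval_Mn: "eval g f (y # xs) 0 \<Longrightarrow> (\<forall>z<y. \<exists>v. v > 0 \<and> eval g f (z # xs) v)
              \<Longrightarrow> eval g (Mn f) xs y"
| eval_Oracle: "eval g Oracle xs (g (case xs of [] \<Rightarrow> 0 | x # _ \<Rightarrow> x))"

definition turing_le :: "(nat \<Rightarrow> nat) \<Rightarrow> (nat \<Rightarrow> nat) \<Rightarrow> bool" where
  "turing_le f g \<longleftrightarrow> (\<exists>c. \<forall>n. eval g c [n] (f n))"

definition computable :: "(nat \<Rightarrow> nat) \<Rightarrow> bool" where
  "computable f \<longleftrightarrow> turing_le f (\<lambda>_. 0)"

definition ce :: "nat set \<Rightarrow> bool" where
  "ce A \<longleftrightarrow> (\<exists>c. \<forall>n. n \<in> A \<longleftrightarrow> (\<exists>y. eval (\<lambda>_. 0) c [n] y))"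

definition chi :: "nat set \<Rightarrow> nat \<Rightarrow> nat" where
  "chi D n = (if n \<in> D then 1 else 0)"

definition sep_problem :: "nat set \<Rightarrow> nat set \<Rightarrow> (nat \<Rightarrow> nat) set" where
  "sep_problem A B = {chi D | D. A \<subseteq> D \<and> B \<inter> D = {}}"

definition is_sep_problem :: "(nat \<Rightarrow> nat) set \<Rightarrow> bool" where
  "is_sep_problem P \<longleftrightarrow> (\<exists>A B. ce A \<and> ce B \<and> A \<inter> B = {} \<and> P = sep_problem A B)"

definition unsolvable :: "(nat \<Rightarrow> nat) set \<Rightarrow> bool" where
  "unsolvable P \<longleftrightarrow> \<not> (\<exists>f\<in>P. computable f)"

definition weak_le :: "(nat \<Rightarrow> nat) set \<Rightarrow> (nat \<Rightarrow> nat) set \<Rightarrow> bool" where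
  "weak_le Q P \<longleftrightarrow> (\<forall>g\<in>P. \<exists>f\<in>Q. turing_le f g)"

end

theory Submission
  imports Defs "HOL-Library.Nat_Bijection"
begin

text \<open>
  Let \<open>P\<close> be the separation problem of \<open>\<langle>A, B\<rangle>\<close>. A Sacks splitting \<open>A = A\<^sub>0 \<union> A\<^sub>1\<close> into disjoint
  c.e. sets can be made so that neither half computes a separator of \<open>\<langle>A, B\<rangle>\<close>: the requirement that
  the functional \<open>\<Phi>\<^sub>e\<close> with oracle \<open>A\<^sub>i\<close> be no separator preserves the computations of \<open>\<Phi>\<^sub>e\<close> up to
  the first argument where they do not look like a separator; if infinitely much were preserved, a
  separator would be computable. Take for \<open>Q\<close> the separation problem of \<open>\<langle>A\<^sub>0, B\<rangle>\<close>. Every separator of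
  \<open>\<langle>A, B\<rangle>\<close> is one of \<open>\<langle>A\<^sub>0, B\<rangle>\<close>, and \<open>A\<^sub>0\<close> itself is a member of \<open>Q\<close> that computes no member of
  \<open>P\<close>. If \<open>D\<close> were a computable separator of \<open>\<langle>A\<^sub>0, B\<rangle>\<close>, then \<open>D \<union> A\<^sub>1\<close> would separate \<open>\<langle>A, B\<rangle>\<close> and
  be computable from \<open>A\<^sub>1\<close>, so \<open>Q\<close> is unsolvable.
\<close>

subsection \<open>Closure properties of relative computability\<close>

inductive_cases eval_MnE: "eval g (Mn f) xs y"

lemma eval_Proj': "i < length xs \<Longrightarrow> y = xs ! i \<Longrightarrow> eval g (Proj i) xs y"
  using eval_Proj by blast

lemma eval_Succ_Cons: "y = Suc x \<Longrightarrow> eval g Succ (x # xs) y"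
  using eval_Succ [of g "x # xs"] by simp

lemma eval_Comp1: "eval g h xs a \<Longrightarrow> eval g f [a] y \<Longrightarrow> eval g (Comp f [h]) xs y"
  by (rule eval_Comp [where ys = "[a]"]) simp_all

lemma eval_Comp2:
  "eval g h xs a \<Longrightarrow> eval g k xs b \<Longrightarrow> eval g f [a, b] y \<Longrightarrow> eval g (Comp f [h, k]) xs y"
  by (rule eval_Comp [where ys = "[a, b]"]) simp_all

lemma eval_Prim_rec_nat:
  assumes "eval g f xs a" and "\<And>k r. eval g h (k # r # xs) (b k r)"
  shows "eval g (Prim f h) (n # xs) (rec_nat a b n)"
proof (induction n)
  case 0
  show ?case using eval_Prim0 assms(1) by simp
next
  case (Suc n)
  show ?case using eval_PrimS [OF Suc assms(2)] by simp
qed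

lemma eval_Mn_Least:
  assumes "\<And>y. eval g f (y # xs) (F y)" and "\<exists>y. F y = 0"
  shows "eval g (Mn f) xs (LEAST y. F y = 0)"
proof (rule eval_Mn)
  show "eval g f ((LEAST y. F y = 0) # xs) 0"
    using assms(1) [of "LEAST y. F y = 0"] LeastI_ex [OF assms(2)] by simp
  show "\<forall>z<LEAST y. F y = 0. \<exists>v>0. eval g f (z # xs) v"
    using assms(1) not_less_Least by blast
qed

lemma program_add: "\<exists>c. \<forall>x y. eval g c [x, y] (x + y)"
proof -
  have "rec_nat y (\<lambda>k r. Suc r) x = x + y" for x y
    by (induction x) simp_all
  moreover have "eval g (Prim (Proj 0) (Comp Succ [Proj 1])) [x, y] (rec_nat y (\<lambda>k r. Suc r) x)" for x y
    by (intro eval_Prim_rec_nat eval_Comp1 eval_Proj' eval_Succ_Cons) simp_all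
  ultimately show ?thesis by metis
qed

lemma program_diff: "\<exists>c. \<forall>x y. eval g c [x, y] (x - y)"
proof -
  have "rec_nat x (\<lambda>k r. r - 1) y = x - y" for x y :: nat
    by (induction y) simp_all
  \<comment> \<open>Predecessor: the recursion drops the previous value and returns its
    counter.\<close>
  moreover have "eval g (Prim Zero (Proj 0)) [x] (x - 1)" for x
    using eval_Prim_rec_nat [of g Zero "[]" 0 "Proj 0" "\<lambda>k r. k" x]
    by (cases x) (simp_all add: eval_Zero eval_Proj')
  then have "eval g (Prim (Proj 0) (Comp (Prim Zero (Proj 0)) [Proj 1])) [y, x]
      (rec_nat x (\<lambda>k r. r - 1) y)" for x y
    by (intro eval_Prim_rec_nat eval_Comp1 eval_Proj') auto
  \<comment> \<open>\<open>Prim\<close> recurses on its first argument, so the subtrahend has to be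
    moved to the front.\<close>
  then have "eval g (Comp (Prim (Proj 0) (Comp (Prim Zero (Proj 0)) [Proj 1])) [Proj 1, Proj 0]) [x, y]
      (rec_nat x (\<lambda>k r. r - 1) y)" for x y
    by (intro eval_Comp2 [where a = y and b = x] eval_Proj') auto
  ultimately show ?thesis by metis
qed

lemma program_triangle: "\<exists>c. \<forall>x. eval g c [x] (triangle x)"
proof -
  obtain p where p: "\<And>x y. eval g p [x, y] (x + y)" using program_add by blast
  have "rec_nat 0 (\<lambda>k r. r + Suc k) x = triangle x" for x
    by (induction x) simp_all
  moreover have "eval g (Comp p [Proj 1, Comp Succ [Proj 0]]) [k, r] (r + Suc k)" for k r
    by (rule eval_Comp2 [OF _ _ p]) (auto intro!: eval_Comp1 eval_Proj' eval_Succ_Cons)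
  then have "eval g (Prim Zero (Comp p [Proj 1, Comp Succ [Proj 0]])) [x] (rec_nat 0 (\<lambda>k r. r + Suc k) x)" for x
    by (intro eval_Prim_rec_nat) (auto intro: eval_Zero)
  ultimately show ?thesis by metis
qed

lemma program_prod_encode: "\<exists>c. \<forall>x y. eval g c [x, y] (prod_encode (x, y))"
proof -
  obtain p where p: "\<And>x y. eval g p [x, y] (x + y)" using program_add by blast
  obtain t where t: "\<And>x. eval g t [x] (triangle x)" using program_triangle by blast
  have "eval g (Comp p [Comp t [p], Proj 0]) [x, y] (prod_encode (x, y))" for x y
    unfolding prod_encode_def prod.case
    by (rule eval_Comp2 [OF _ _ p]) (auto intro!: eval_Comp1 [OF p t] eval_Proj')
  then show ?thesis by blast
qed

lemma triangle_mono: "m \<le> n \<Longrightarrow> triangle m \<le> triangle n"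
  by (rule lift_Suc_mono_le [of triangle]) simp_all

text \<open>The code of a pair lies between the triangle numbers of its diagonal and of the next
  one, so unbounded search finds the diagonal. Truncated subtraction turns the comparison into a
  test for zero.\<close>

lemma Least_diagonal: "(LEAST k. Suc (prod_encode (x, y)) - triangle (Suc k) = 0) = x + y"
proof (rule Least_equality)
  show "Suc (prod_encode (x, y)) - triangle (Suc (x + y)) = 0"
    by (simp add: prod_encode_def)
  show "x + y \<le> k" if "Suc (prod_encode (x, y)) - triangle (Suc k) = 0" for k
  proof (rule ccontr)
    assume "\<not> x + y \<le> k"
    then have "triangle (Suc k) \<le> triangle (x + y)" by (intro triangle_mono) simp
    with that show False by (simp add: prod_encode_def)
  qed
qed

lemma program_prod_decode:
  "\<exists>c. \<forall>x y. eval g c [prod_encode (x, y)] x" "\<exists>c. \<forall>x y. eval g c [prod_encode (x, y)] y"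
proof -
  obtain d where d: "\<And>x y. eval g d [x, y] (x - y)" using program_diff by blast
  obtain t where t: "\<And>x. eval g t [x] (triangle x)" using program_triangle by blast
  define m where "m = Mn (Comp d [Comp Succ [Proj 1], Comp t [Comp Succ [Proj 0]]])"
  have "eval g (Comp d [Comp Succ [Proj 1], Comp t [Comp Succ [Proj 0]]]) [k, n] (Suc n - triangle (Suc k))" for k n
    by (rule eval_Comp2 [OF _ _ d] eval_Comp1 [OF _ t] eval_Comp1 eval_Succ_Cons eval_Proj' | simp)+
  then have "eval g m [n] (LEAST k. Suc n - triangle (Suc k) = 0)" if "\<exists>k. Suc n - triangle (Suc k) = 0" for n
    unfolding m_def using that by (intro eval_Mn_Least)
  moreover have "Suc (prod_encode (x, y)) - triangle (Suc (x + y)) = 0" for x y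
    by (simp add: prod_encode_def)
  ultimately have m: "eval g m [prod_encode (x, y)] (x + y)" for x y
    using Least_diagonal [of x y] by metis
  \<comment> \<open>The first component is the offset of the code from the start of its diagonal;
    the second is what remains of the diagonal number.\<close>
  have f: "eval g (Comp d [Proj 0, Comp t [m]]) [prod_encode (x, y)] x" for x y
  proof -
    have "eval g (Comp d [Proj 0, Comp t [m]]) [prod_encode (x, y)] (prod_encode (x, y) - triangle (x + y))"
      by (rule eval_Comp2 [OF eval_Proj' eval_Comp1 [OF m t] d]) simp_all
    then show ?thesis by (simp add: prod_encode_def)
  qed
  then show "\<exists>c. \<forall>x y. eval g c [prod_encode (x, y)] x" by blast
  have "eval g (Comp d [m, Comp d [Proj 0, Comp t [m]]]) [prod_encode (x, y)] y" for x y
    using eval_Comp2 [OF m f d] by simp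
  then show "\<exists>c. \<forall>x y. eval g c [prod_encode (x, y)] y" by blast
qed

section \<open>Relative computability on encoded types\<close>

text \<open>Codes are bijective, not just injective: quantifiers over the type become quantifiers
  over numbers, and on codes \<open>enc\<close> and \<open>dec\<close> act as the identity.\<close>

class encodable =
  fixes enc :: "'a \<Rightarrow> nat" and dec :: "nat \<Rightarrow> 'a"
  assumes dec_enc [simp]: "dec (enc x) = x" and enc_dec [simp]: "enc (dec n) = n"

lemma enc_eq_iff: "enc x = enc y \<longleftrightarrow> x = y"
  by (metis dec_enc)

instantiation nat :: encodable
begin
definition "enc (n::nat) = n"
definition "dec (n::nat) = n"
instance by standard (simp_all add: enc_nat_def dec_nat_def)
end

instantiation prod :: (encodable, encodable) encodable
begin
definition "enc p = prod_encode (enc (fst p), enc (snd p))"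
definition "dec n = map_prod dec dec (prod_decode n)"
instance by standard (simp_all add: enc_prod_def dec_prod_def)
end

instantiation list :: (encodable) encodable
begin
definition "enc xs = list_encode (map enc xs)"
definition "dec n = map dec (list_decode n)"
instance by standard (simp_all add: enc_list_def dec_list_def comp_def)
end

lemma enc_Pair: "enc (x, y) = prod_encode (enc x, enc y)"
  by (simp add: enc_prod_def)

text \<open>Reduces list operations to successor, predecessor and the two projections.\<close>

lemma enc_Cons: "enc (x # xs) = Suc (enc (x, xs))"
  by (simp add: enc_list_def enc_prod_def)

definition rec_in :: "(nat \<Rightarrow> nat) \<Rightarrow> ('a::encodable \<Rightarrow> 'b::encodable) \<Rightarrow> bool" where
  "rec_in g f \<longleftrightarrow> (\<exists>c. \<forall>x. eval g c [enc x] (enc (f x)))"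

definition dec_in :: "(nat \<Rightarrow> nat) \<Rightarrow> ('a::encodable \<Rightarrow> bool) \<Rightarrow> bool" where
  "dec_in g P \<longleftrightarrow> rec_in g (\<lambda>x. of_bool (P x) :: nat)"

lemma rec_in_iff_turing_le: "rec_in g f \<longleftrightarrow> turing_le f g"
  by (simp add: rec_in_def turing_le_def enc_nat_def)

named_theorems rec_intros

lemma rec_in_id [rec_intros]: "rec_in g (\<lambda>x. x)"
  unfolding rec_in_def by (intro exI [of _ "Proj 0"]) (simp add: eval_Proj')

lemma rec_in_comp: "rec_in g f \<Longrightarrow> rec_in g h \<Longrightarrow> rec_in g (\<lambda>x. f (h x))"
  unfolding rec_in_def by (meson eval_Comp1)

lemma rec_in_const [rec_intros]: "rec_in g (\<lambda>x. k)"
proof -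
  have "\<exists>c. \<forall>x. eval g c [x] n" for n
  proof (induction n)
    case (Suc n)
    then obtain c where "\<And>x. eval g c [x] n" by blast
    then have "eval g (Comp Succ [c]) [x] (Suc n)" for x
      by (intro eval_Comp1 eval_Succ_Cons) simp_all
    then show ?case by blast
  qed (auto intro: eval_Zero)
  then show ?thesis unfolding rec_in_def by blast
qed

lemma rec_in_Pair [rec_intros]: "rec_in g a \<Longrightarrow> rec_in g b \<Longrightarrow> rec_in g (\<lambda>x. (a x, b x))"
  unfolding rec_in_def enc_Pair by (meson eval_Comp2 program_prod_encode)

lemma rec_in_fst [rec_intros]:
  fixes a :: "'a::encodable \<Rightarrow> 'b::encodable \<times> 'c::encodable"
  assumes "rec_in g a" shows "rec_in g (\<lambda>x. fst (a x))"
proof -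
  have "rec_in g (fst :: 'b \<times> 'c \<Rightarrow> 'b)"
    unfolding rec_in_def enc_prod_def using program_prod_decode(1) by blast
  then show ?thesis using rec_in_comp assms by blast
qed

lemma rec_in_snd [rec_intros]:
  fixes a :: "'a::encodable \<Rightarrow> 'b::encodable \<times> 'c::encodable"
  assumes "rec_in g a" shows "rec_in g (\<lambda>x. snd (a x))"
proof -
  have "rec_in g (snd :: 'b \<times> 'c \<Rightarrow> 'c)"
    unfolding rec_in_def enc_prod_def using program_prod_decode(2) by blast
  then show ?thesis using rec_in_comp assms by blast
qed

lemma rec_in_enc [rec_intros]: "rec_in g a \<Longrightarrow> rec_in g (\<lambda>x. enc (a x))"
  unfolding rec_in_def by (simp add: enc_nat_def)

lemma rec_in_dec [rec_intros]: "rec_in g a \<Longrightarrow> rec_in g (\<lambda>x. dec (a x))"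
  unfolding rec_in_def by (simp add: enc_nat_def)

lemma rec_in_oracle: "rec_in g a \<Longrightarrow> rec_in g (\<lambda>x. g (a x))"
proof (rule rec_in_comp [of g g])
  show "rec_in g g" unfolding rec_in_def enc_nat_def
    using eval_Oracle [of g "[_]"] by (intro exI [of _ Oracle]) auto
qed

lemma rec_in_rec_nat [rec_intros]:
  fixes a :: "'a::encodable \<Rightarrow> 'b::encodable"
  assumes a: "rec_in g a" and n: "rec_in g n"
    and b: "rec_in g (\<lambda>p. b (fst p) (fst (snd p)) (snd (snd p)))"
  shows "rec_in g (\<lambda>x. rec_nat (a x) (b x) (n x))"
proof -
  obtain ca where ca: "\<And>x. eval g ca [enc x] (enc (a x))" using a unfolding rec_in_def by blast
  obtain cn where cn: "\<And>x. eval g cn [enc x] (n x)" using n unfolding rec_in_def enc_nat_def by blast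
  obtain cb where cb: "\<And>x k r. eval g cb [enc (x, k, r)] (enc (b x k r))"
    using b unfolding rec_in_def by (metis fst_conv snd_conv)
  obtain cp where cp: "\<And>x y. eval g cp [x, y] (prod_encode (x, y))" using program_prod_encode by blast
  \<comment> \<open>\<open>Prim\<close> supplies counter, previous value and parameter in this
    order, while \<open>cb\<close> expects a single code with the parameter first.\<close>
  have "eval g (Comp cb [Comp cp [Proj 2, Comp cp [Proj 0, Proj 1]]]) [k, r, enc x] (enc (b x k (dec r)))" for k r x
  proof (rule eval_Comp1 [OF _ cb])
    show "eval g (Comp cp [Proj 2, Comp cp [Proj 0, Proj 1]]) [k, r, enc x] (enc (x, k, dec r :: 'b))"
      unfolding enc_Pair enc_dec enc_nat_def
      by (rule eval_Comp2 [OF _ _ cp] eval_Comp2 [OF _ _ cp] eval_Proj' | simp)+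
  qed
  then have "eval g (Prim ca (Comp cb [Comp cp [Proj 2, Comp cp [Proj 0, Proj 1]]])) [m, enc x]
    (rec_nat (enc (a x)) (\<lambda>k r. enc (b x k (dec r))) m)" for m x
    by (intro eval_Prim_rec_nat ca)
  moreover have "rec_nat (enc (a x)) (\<lambda>k r. enc (b x k (dec r))) m = enc (rec_nat (a x) (b x) m)" for m x
    by (induction m) simp_all
  ultimately have "eval g (Comp (Prim ca (Comp cb [Comp cp [Proj 2, Comp cp [Proj 0, Proj 1]]])) [cn, Proj 0]) [enc x]
    (enc (rec_nat (a x) (b x) (n x)))" for x
    by (intro eval_Comp2 [OF cn]) (auto intro: eval_Proj')
  then show ?thesis unfolding rec_in_def by blast
qed

lemma rec_in_Suc [rec_intros]: "rec_in g a \<Longrightarrow> rec_in g (\<lambda>x. Suc (a x))"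
  unfolding rec_in_def enc_nat_def by (blast intro: eval_Comp1 eval_Succ_Cons)

lemma rec_in_diff [rec_intros]: "rec_in g a \<Longrightarrow> rec_in g b \<Longrightarrow> rec_in g (\<lambda>x. a x - b x :: nat)"
  unfolding rec_in_def enc_nat_def by (meson eval_Comp2 program_diff)

lemma rec_in_If [rec_intros]:
  assumes "dec_in g P" "rec_in g a" "rec_in g b" shows "rec_in g (\<lambda>x. if P x then a x else b x)"
proof -
  \<comment> \<open>Case distinction is a recursion of length 0 or 1.\<close>
  have "rec_in g (\<lambda>x. rec_nat (b x) (\<lambda>k r. a x) (of_bool (P x)))"
    using assms unfolding dec_in_def
    by (intro rec_in_rec_nat rec_in_comp [OF assms(2), of fst] rec_in_fst rec_in_id)
  moreover have "rec_nat (b x) (\<lambda>k r. a x) (of_bool (P x)) = (if P x then a x else b x)" for x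
    by simp
  ultimately show ?thesis by simp
qed

lemma dec_in_comp: "dec_in g P \<Longrightarrow> rec_in g a \<Longrightarrow> dec_in g (\<lambda>x. P (a x))"
  unfolding dec_in_def by (rule rec_in_comp)

lemma dec_in_const [rec_intros]: "dec_in g (\<lambda>x. b)"
  unfolding dec_in_def by (rule rec_in_const)

lemma dec_in_not [rec_intros]: "dec_in g P \<Longrightarrow> dec_in g (\<lambda>x. \<not> P x)"
proof -
  assume "dec_in g P"
  then have "rec_in g (\<lambda>x. 1 - of_bool (P x) :: nat)"
    unfolding dec_in_def by (intro rec_intros)
  moreover have "1 - of_bool (P x) = (of_bool (\<not> P x) :: nat)" for x by simp
  ultimately show ?thesis unfolding dec_in_def by simp
qed

lemma dec_in_conj [rec_intros]: "dec_in g P \<Longrightarrow> dec_in g Q \<Longrightarrow> dec_in g (\<lambda>x. P x \<and> Q x)"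
proof -
  assume "dec_in g P" "dec_in g Q"
  then have "rec_in g (\<lambda>x. if P x then of_bool (Q x) else 0 :: nat)"
    by (intro rec_intros) (simp_all add: dec_in_def)
  moreover have "(if P x then of_bool (Q x) else 0) = (of_bool (P x \<and> Q x) :: nat)" for x by simp
  ultimately show ?thesis unfolding dec_in_def by simp
qed

lemma dec_in_disj [rec_intros]: "dec_in g P \<Longrightarrow> dec_in g Q \<Longrightarrow> dec_in g (\<lambda>x. P x \<or> Q x)"
  using dec_in_not [OF dec_in_conj [OF dec_in_not dec_in_not]] by (simp add: de_Morgan_conj)

lemma dec_in_imp [rec_intros]: "dec_in g P \<Longrightarrow> dec_in g Q \<Longrightarrow> dec_in g (\<lambda>x. P x \<longrightarrow> Q x)"
  unfolding imp_conv_disj by (intro rec_intros)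

lemma dec_in_le [rec_intros]: 
  assumes "rec_in g a" "rec_in g b" shows "dec_in g (\<lambda>x. a x \<le> (b x :: nat))"
proof -
  have "rec_in g (\<lambda>x. 1 - (a x - b x))" using assms by (intro rec_intros)
  moreover have "1 - (a x - b x) = of_bool (a x \<le> b x)" for x by auto
  ultimately show ?thesis unfolding dec_in_def by simp
qed

lemma dec_in_less [rec_intros]: 
  "rec_in g a \<Longrightarrow> rec_in g b \<Longrightarrow> dec_in g (\<lambda>x. a x < (b x :: nat))"
  unfolding Suc_le_eq [symmetric] by (intro rec_intros)

lemma dec_in_eq [rec_intros]: 
  assumes "rec_in g a" "rec_in g b" shows "dec_in g (\<lambda>x. a x = b x)"
proof -
  have "dec_in g (\<lambda>x. enc (a x) \<le> enc (b x) \<and> enc (b x) \<le> enc (a x))"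
    using assms by (intro rec_intros)
  moreover have "enc (a x) \<le> enc (b x) \<and> enc (b x) \<le> enc (a x) \<longleftrightarrow> a x = b x" for x
    using enc_eq_iff [of "a x" "b x"] by auto
  ultimately show ?thesis by simp
qed

lemma dec_in_ball [rec_intros]:
  assumes P: "dec_in g (\<lambda>p. P (fst p) (snd p))" and b: "rec_in g b"
  shows "dec_in g (\<lambda>x. \<forall>k < b x. P x (k::nat))"
proof -
  have "rec_in g (\<lambda>x. rec_nat (1::nat) (\<lambda>k r. if P x k then r else 0) (b x))"
    by (intro rec_in_rec_nat rec_in_If rec_in_snd rec_in_const rec_in_id b
       dec_in_comp [OF P, of "\<lambda>p. (fst p, fst (snd p))", simplified] rec_in_Pair rec_in_fst)
  moreover have "rec_nat 1 (\<lambda>k r. if P x k then r else 0) n = (of_bool (\<forall>k<n. P x k) :: nat)" for x n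
    by (induction n) (auto simp: less_Suc_eq)
  ultimately show ?thesis unfolding dec_in_def by simp
qed

lemma dec_in_bex [rec_intros]:
  assumes "dec_in g (\<lambda>p. P (fst p) (snd p))" and "rec_in g b"
  shows "dec_in g (\<lambda>x. \<exists>k < b x. P x (k::nat))"
  using dec_in_not [OF dec_in_ball [OF dec_in_not [OF assms(1)] assms(2)]] by simp

text \<open>Bounding the code gives bounded search over any encodable type, later over
  derivations.\<close>

lemma dec_in_bex_enc [rec_intros]:
  assumes "dec_in g (\<lambda>p. P (fst p) (snd p))" and "rec_in g b"
  shows "dec_in g (\<lambda>x. \<exists>k. enc k < b x \<and> P x k)"
proof -
  have "dec_in g (\<lambda>p. P (fst p) (dec (snd p)))"
    using dec_in_comp [OF assms(1), of "\<lambda>p. (fst p, dec (snd p))"] by (simp add: rec_intros)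
  then have "dec_in g (\<lambda>x. \<exists>k < b x. P x (dec k))" using assms(2) by (intro rec_intros)
  moreover have "(\<exists>k < b x. P x (dec k)) \<longleftrightarrow> (\<exists>k. enc k < b x \<and> P x k)" for x
    by (metis enc_dec dec_enc)
  ultimately show ?thesis by simp
qed

lemma rec_in_Least:
  assumes P: "dec_in g (\<lambda>p. P (fst p) (snd p))" and ex: "\<And>x. \<exists>k. P x k"
  shows "rec_in g (\<lambda>x. LEAST k::nat. P x k)"
proof -
  obtain c where c: "\<And>x k. eval g c [enc (x, k)] (of_bool (\<not> P x k))"
    using dec_in_not [OF P] unfolding dec_in_def rec_in_def enc_nat_def by (metis fst_conv snd_conv)
  obtain cp where cp: "\<And>x y. eval g cp [x, y] (prod_encode (x, y))" using program_prod_encode by blast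
  have "eval g (Comp c [Comp cp [Proj 1, Proj 0]]) [k, enc x] (of_bool (\<not> P x k))" for k x
    by (rule eval_Comp1 [OF _ c]) (auto simp: enc_Pair enc_nat_def intro!: eval_Comp2 [OF _ _ cp] eval_Proj')
  then have "eval g (Mn (Comp c [Comp cp [Proj 1, Proj 0]])) [enc x] (LEAST k. of_bool (\<not> P x k) = (0::nat))" for x
    using ex by (intro eval_Mn_Least) auto
  then show ?thesis unfolding rec_in_def enc_nat_def by auto
qed

lemma rec_in_Cons [rec_intros]:
  assumes "rec_in g a" "rec_in g b" shows "rec_in g (\<lambda>x. a x # b x)"
proof -
  have "rec_in g (\<lambda>x. Suc (enc (a x, b x)))" using assms by (intro rec_intros)
  then show ?thesis unfolding rec_in_def enc_Cons [symmetric] by (simp add: enc_nat_def)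
qed

lemma rec_in_tl [rec_intros]:
  fixes a :: "'a::encodable \<Rightarrow> 'b::encodable list"
  assumes "rec_in g a" shows "rec_in g (\<lambda>x. tl (a x))"
proof -
  have "rec_in g (\<lambda>x. if a x = [] then [] else snd (dec (enc (a x) - 1) :: 'b \<times> 'b list))"
    using assms by (intro rec_intros)
  moreover have "(if l = [] then [] else snd (dec (enc l - 1) :: 'b \<times> 'b list)) = tl l" for l
    by (cases l) (simp_all add: enc_Cons)
  ultimately show ?thesis by simp
qed

lemma rec_in_hd [rec_intros]:
  fixes a :: "'a::encodable \<Rightarrow> 'b::encodable list"
  assumes "rec_in g a" shows "rec_in g (\<lambda>x. hd (a x))"
proof -
  have "rec_in g (\<lambda>x. if a x = [] then hd [] else fst (dec (enc (a x) - 1) :: 'b \<times> 'b list))"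
    using assms by (intro rec_intros)
  moreover have "(if l = [] then hd [] else fst (dec (enc l - 1) :: 'b \<times> 'b list)) = hd l" for l
    by (cases l) (simp_all add: enc_Cons)
  ultimately show ?thesis by simp
qed

lemma rec_in_drop [rec_intros]:
  fixes a :: "'a::encodable \<Rightarrow> 'b::encodable list"
  assumes "rec_in g n" "rec_in g a" shows "rec_in g (\<lambda>x. drop (n x) (a x))"
proof -
  have "rec_in g (\<lambda>x. rec_nat (a x) (\<lambda>k r. tl r) (n x))"
    using assms by (intro rec_intros)
  moreover have "rec_nat l (\<lambda>k r. tl r) m = drop m l" for m and l :: "'b list"
    by (induction m) (simp_all add: drop_Suc tl_drop)
  ultimately show ?thesis by simp
qed

lemma rec_in_length [rec_intros]:
  fixes a :: "'a::encodable \<Rightarrow> 'b::encodable list"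
  assumes "rec_in g a" shows "rec_in g (\<lambda>x. length (a x))"
proof -
  have "rec_in g (\<lambda>x. LEAST n. drop n (a x) = [])"
    by (rule rec_in_Least) (intro rec_intros rec_in_comp [OF assms], auto)
  moreover have "(LEAST n. drop n l = []) = length l" for l :: "'b list"
    by (rule Least_equality) auto
  ultimately show ?thesis by simp
qed

lemma dec_in_bex_list [rec_intros]:
  assumes P: "dec_in g (\<lambda>p. P (fst p) (snd p))" and a: "rec_in g a"
  shows "dec_in g (\<lambda>x. \<exists>y \<in> set (a x). P x y)"
proof -
  have "dec_in g (\<lambda>p. P (fst p) (hd (drop (snd p) (a (fst p)))))"
    using dec_in_comp [OF P, of "\<lambda>p. (fst p, hd (drop (snd p) (a (fst p))))"]
    by (simp add: rec_intros rec_in_comp [OF a])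
  then have "dec_in g (\<lambda>x. \<exists>i < length (a x). P x (hd (drop i (a x))))"
    using a by (intro rec_intros)
  moreover have "(\<exists>i < length l. P x (hd (drop i l))) \<longleftrightarrow> (\<exists>y \<in> set l. P x y)" for x l
    by (metis hd_drop_conv_nth in_set_conv_nth)
  ultimately show ?thesis by simp
qed

lemma dec_in_member [rec_intros]:
  assumes "rec_in g a" "rec_in g l" shows "dec_in g (\<lambda>x. a x \<in> set (l x))"
proof -
  have "dec_in g (\<lambda>x. \<exists>y \<in> set (l x). y = a x)"
    by (intro rec_intros rec_in_comp [OF assms(1)] assms(2))
  then show ?thesis by simp
qed

subsection \<open>Evaluation as derivability\<close>

text \<open>The map is not onto. Numbers outside its range only add requirements to the
  splitting.\<close>

fun code :: "recf \<Rightarrow> nat" where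
  "code Zero = enc (0::nat, 0::nat)"
| "code Succ = enc (1::nat, 0::nat)"
| "code (Proj i) = enc (2::nat, i)"
| "code (Comp f hs) = enc (3::nat, code f, map code hs)"
| "code (Prim f h) = enc (4::nat, code f, code h)"
| "code (Mn f) = enc (5::nat, code f)"
| "code Oracle = enc (6::nat, 0::nat)"

text \<open>
  A judgement \<open>(c, xs, y)\<close> says that the program coded by \<open>c\<close> maps \<open>xs\<close> to \<open>y\<close>. A valid derivation
  lists each judgement before the ones that justify it; the oracle is \<open>X\<close>, queried only below \<open>u\<close>.
  Codes with a tag above 6 are never justified.
\<close>

type_synonym judgement = "nat \<times> nat list \<times> nat"

text \<open>All rules use \<open>dec\<close>, projections and \<open>hd (drop i _)\<close> instead
  of patterns, so that the closure rules prove their decidability by following the syntax.\<close>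

definition just_Zero :: "nat \<Rightarrow> nat \<Rightarrow> bool" where
  "just_Zero c y \<longleftrightarrow> fst (dec c :: nat \<times> nat) = 0 \<and> y = 0"

text \<open>The default 0 agrees with \<open>eval_Succ\<close> and \<open>eval_Oracle\<close> on the
  empty list.\<close>

definition head0 :: "nat list \<Rightarrow> nat" where
  "head0 xs = (if xs = [] then 0 else hd xs)"

definition just_Succ :: "nat \<Rightarrow> nat list \<Rightarrow> nat \<Rightarrow> bool" where
  "just_Succ c xs y \<longleftrightarrow> fst (dec c :: nat \<times> nat) = 1 \<and> y = Suc (head0 xs)"

definition just_Proj :: "nat \<Rightarrow> nat list \<Rightarrow> nat \<Rightarrow> bool" where
  "just_Proj c xs y \<longleftrightarrow> fst (dec c :: nat \<times> nat) = 2 \<and> snd (dec c :: nat \<times> nat) < length xs \<and>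
     y = hd (drop (snd (dec c :: nat \<times> nat)) xs)"

text \<open>\<open>j\<close> is the judgement on the outer function. Its argument list already names
  the values of the inner functions, so searching \<open>D\<close> is enough.\<close>

definition just_Comp :: "judgement list \<Rightarrow> nat \<Rightarrow> nat list \<Rightarrow> nat \<Rightarrow> bool" where
  "just_Comp D c xs y \<longleftrightarrow> fst (dec c :: nat \<times> nat \<times> nat list) = 3 \<and>
     (\<exists>j\<in>set D. fst j = fst (snd (dec c :: nat \<times> nat \<times> nat list)) \<and> snd (snd j) = y \<and>
        length (fst (snd j)) = length (snd (snd (dec c :: nat \<times> nat \<times> nat list))) \<and>
        (\<forall>i<length (fst (snd j)). 
          (hd (drop i (snd (snd (dec c :: nat \<times> nat \<times> nat list)))), xs, hd (drop i (fst (snd j)))) \<in> set D))"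

definition just_Prim :: "judgement list \<Rightarrow> nat \<Rightarrow> nat list \<Rightarrow> nat \<Rightarrow> bool" where
  "just_Prim D c xs y \<longleftrightarrow> fst (dec c :: nat \<times> nat \<times> nat) = 4 \<and> xs \<noteq> [] \<and>
     (hd xs = 0 \<and> (fst (snd (dec c :: nat \<times> nat \<times> nat)), tl xs, y) \<in> set D \<or>
      hd xs \<noteq> 0 \<and> (\<exists>j\<in>set D. fst j = c \<and> fst (snd j) = (hd xs - 1) # tl xs \<and>
        (snd (snd (dec c :: nat \<times> nat \<times> nat)), (hd xs - 1) # snd (snd j) # tl xs, y) \<in> set D))"

definition just_Mn :: "judgement list \<Rightarrow> nat \<Rightarrow> nat list \<Rightarrow> nat \<Rightarrow> bool" where
  "just_Mn D c xs y \<longleftrightarrow> fst (dec c :: nat \<times> nat) = 5 \<and>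
     (snd (dec c :: nat \<times> nat), y # xs, 0) \<in> set D \<and>
     (\<forall>z<y. \<exists>j\<in>set D. fst j = snd (dec c :: nat \<times> nat) \<and> fst (snd j) = z # xs \<and> 0 < snd (snd j))"

definition just_Oracle :: "nat set \<Rightarrow> nat \<Rightarrow> nat \<Rightarrow> nat list \<Rightarrow> nat \<Rightarrow> bool" where
  "just_Oracle X u c xs y \<longleftrightarrow> fst (dec c :: nat \<times> nat) = 6 \<and> head0 xs < u \<and>
     y = (if head0 xs \<in> X then 1 else 0)"

definition justified :: "nat set \<Rightarrow> nat \<Rightarrow> judgement list \<Rightarrow> judgement \<Rightarrow> bool" where
  "justified X u D j \<longleftrightarrow> (let c = fst j; xs = fst (snd j); y = snd (snd j) in
     just_Zero c y \<or> just_Succ c xs y \<or> just_Proj c xs y \<or> just_Comp D c xs y \<or>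
     just_Prim D c xs y \<or> just_Mn D c xs y \<or> just_Oracle X u c xs y)"

lemmas just_defs = just_Zero_def just_Succ_def just_Proj_def just_Comp_def just_Prim_def just_Mn_def just_Oracle_def

fun valid :: "nat set \<Rightarrow> nat \<Rightarrow> judgement list \<Rightarrow> bool" where
  "valid X u [] \<longleftrightarrow> True"
| "valid X u (j # D) \<longleftrightarrow> justified X u D j \<and> valid X u D"

lemma justified_mono:
  assumes "justified X u D j" "set D \<subseteq> set D'" "u \<le> u'"
  shows "justified X u' D' j"
proof -
  have "just_Comp D c xs y \<Longrightarrow> just_Comp D' c xs y" for c xs y
    using assms(2) unfolding just_Comp_def by blast
  moreover have "just_Prim D c xs y \<Longrightarrow> just_Prim D' c xs y" for c xs y
    using assms(2) unfolding just_Prim_def by blast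
  moreover have "just_Mn D c xs y \<Longrightarrow> just_Mn D' c xs y" for c xs y
    using assms(2) unfolding just_Mn_def by blast
  moreover have "just_Oracle X u c xs y \<Longrightarrow> just_Oracle X u' c xs y" for c xs y
    using assms(3) unfolding just_Oracle_def by simp
  ultimately show ?thesis using assms(1) unfolding justified_def Let_def by blast
qed

text \<open>Source of the use principle: only the oracle rule consults \<open>X\<close>, and only
  below \<open>u\<close>.\<close>

lemma justified_cong:
  assumes "X \<inter> {..<u} = X' \<inter> {..<u}" shows "justified X u D j \<longleftrightarrow> justified X' u D j"
proof -
  have "q < u \<Longrightarrow> q \<in> X \<longleftrightarrow> q \<in> X'" for q using assms by blast
  then show ?thesis unfolding justified_def Let_def just_Oracle_def by auto
qed

lemma valid_cong: "X \<inter> {..<u} = X' \<inter> {..<u} \<Longrightarrow> valid X u D \<longleftrightarrow> valid X' u D"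
  by (induction D) (auto dest: justified_cong)

lemma valid_mono: "valid X u D \<Longrightarrow> u \<le> u' \<Longrightarrow> valid X u' D"
  by (induction D) (auto intro: justified_mono)

lemma valid_append: "valid X u D \<Longrightarrow> valid X u E \<Longrightarrow> valid X u (D @ E)"
  by (induction D) (auto intro: justified_mono)

lemma valid_justified: "valid X u D \<Longrightarrow> j \<in> set D \<Longrightarrow> justified X u D j"
  by (induction D) (auto intro: justified_mono)

text \<open>Recovers an inversion rule in pattern form from the destructor form of the
  rules.\<close>

lemma justified_cases:
  assumes "justified X u D (c, xs, y)"
  obtains (Zero) p where "c = enc (0::nat, p::nat)" "y = 0"
  | (Succ) p where "c = enc (1::nat, p::nat)" "y = Suc (head0 xs)"
  | (Proj) i where "c = enc (2::nat, i::nat)" "i < length xs" "y = xs ! i"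
  | (Comp) f hs ys where "c = enc (3::nat, f::nat, hs::nat list)" "(f, ys, y) \<in> set D"
      "list_all2 (\<lambda>h v. (h, xs, v) \<in> set D) hs ys"
  | (Prim0) f h xs' where "c = enc (4::nat, f::nat, h::nat)" "xs = 0 # xs'" "(f, xs', y) \<in> set D"
  | (PrimS) f h n xs' r where "c = enc (4::nat, f::nat, h::nat)" "xs = Suc n # xs'"
      "(c, n # xs', r) \<in> set D" "(h, n # r # xs', y) \<in> set D"
  | (Mn) f where "c = enc (5::nat, f::nat)" "(f, y # xs, 0) \<in> set D"
      "\<And>z. z < y \<Longrightarrow> \<exists>v>0. (f, z # xs, v) \<in> set D"
  | (Oracle) p where "c = enc (6::nat, p::nat)" "head0 xs < u" "y = chi X (head0 xs)"
proof -
  \<comment> \<open>The same number is read at three types, because the shape of the payload depends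
    on the tag.\<close>
  obtain t p where c: "c = enc (t::nat, p::nat)" by (metis enc_dec prod.collapse)
  obtain f h where p: "p = enc (f::nat, h::nat)" by (metis enc_dec prod.collapse)
  define hs where "hs = (dec h :: nat list)"
  have c': "c = enc (t, f, h)" "c = enc (t, f, hs)"
    by (simp_all add: c p enc_Pair enc_nat_def hs_def)
  have "dec c = (t, p)" unfolding c by (rule dec_enc)
  moreover have "dec c = (t, f, h)" unfolding c'(1) by (rule dec_enc)
  moreover have "dec c = (t, f, hs)" unfolding c'(2) by (rule dec_enc)
  ultimately have d [simp]: "dec c = (t, p)" "dec c = (t, f, h)" "dec c = (t, f, hs)" by blast+
  from assms consider "just_Zero c y" | "just_Succ c xs y" | "just_Proj c xs y" | "just_Comp D c xs y"
    | "just_Prim D c xs y" | "just_Mn D c xs y" | "just_Oracle X u c xs y"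
    unfolding justified_def Let_def by auto
  then show ?thesis
  proof cases
    case 1 then show ?thesis using Zero c by (simp add: just_defs)
  next
    case 2 then show ?thesis using Succ c by (simp add: just_defs)
  next
    case 3 then show ?thesis using Proj c by (simp add: just_defs hd_drop_conv_nth)
  next
    case 4
    then obtain ys where "t = 3" "(f, ys, y) \<in> set D" "length ys = length hs"
      "\<forall>i<length ys. (hd (drop i hs), xs, hd (drop i ys)) \<in> set D"
      unfolding just_defs d by auto
    then show ?thesis using c'(2)
      by (intro Comp [of f hs ys]) (auto simp: list_all2_conv_all_nth hd_drop_conv_nth)
  next
    case 5
    then have t: "t = 4" and xs: "xs \<noteq> []" by (auto simp: just_defs)
    show ?thesis
    proof (cases "hd xs")
      case 0
      then have "(f, tl xs, y) \<in> set D" using 5 unfolding just_defs d by auto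
      then show ?thesis using Prim0 c'(1) t xs 0 by (metis list.collapse)
    next
      case (Suc n)
      then obtain r where "(c, n # tl xs, r) \<in> set D" "(h, n # r # tl xs, y) \<in> set D"
        using 5 unfolding just_defs d by auto
      then show ?thesis using PrimS c'(1) t xs Suc by (metis list.collapse)
    qed
  next
    case 6
    then have "t = 5" "(p, y # xs, 0) \<in> set D" "\<And>z. z < y \<Longrightarrow> \<exists>v>0. (p, z # xs, v) \<in> set D"
      unfolding just_defs d by auto (metis prod.collapse)
    then show ?thesis using Mn c by blast
  next
    case 7 then show ?thesis using Oracle c by (simp add: just_defs chi_def)
  qed
qed

text \<open>The tag of \<open>c\<close> forces the same rule on both sides, and \<open>det\<close>
  identifies the values in the premises.\<close>

lemma justified_deterministic:
  assumes "justified X u D (c, xs, y)" "justified X u' D' (c, xs, y')"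
    and det: "\<And>c xs y y'. (c, xs, y) \<in> set D \<Longrightarrow> (c, xs, y') \<in> set D' \<Longrightarrow> y = y'"
  shows "y = y'"
  using assms(1)
proof (cases rule: justified_cases)
  case Zero
  from assms(2) show ?thesis by (cases rule: justified_cases) (use Zero in \<open>auto simp: enc_Pair enc_nat_def\<close>)
next
  case Succ
  from assms(2) show ?thesis by (cases rule: justified_cases) (use Succ in \<open>auto simp: enc_Pair enc_nat_def\<close>)
next
  case Proj
  from assms(2) show ?thesis by (cases rule: justified_cases) (use Proj in \<open>auto simp: enc_Pair enc_nat_def\<close>)
next
  case (Comp f hs ys)
  from assms(2) obtain ys' where ys': "(f, ys', y') \<in> set D'"
      "list_all2 (\<lambda>h v. (h, xs, v) \<in> set D') hs ys'"
    by (cases rule: justified_cases) (use Comp in \<open>auto simp: enc_Pair enc_nat_def enc_eq_iff\<close>)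
  have "ys = ys'"
  proof (rule nth_equalityI)
    show "length ys = length ys'"
      using list_all2_lengthD [OF Comp(3)] list_all2_lengthD [OF ys'(2)] by simp
    show "ys ! i = ys' ! i" if "i < length ys" for i
      using that Comp(3) ys'(2) det unfolding list_all2_conv_all_nth by metis
  qed
  then show ?thesis using det Comp(2) ys'(1) by blast
next
  case (Prim0 f h xs')
  from assms(2) have "(f, xs', y') \<in> set D'"
    by (cases rule: justified_cases) (use Prim0 in \<open>auto simp: enc_Pair enc_nat_def\<close>)
  then show ?thesis using det Prim0(3) by blast
next
  case (PrimS f h n xs' r)
  from assms(2) obtain r' where "(c, n # xs', r') \<in> set D'" "(h, n # r' # xs', y') \<in> set D'"
    by (cases rule: justified_cases) (use PrimS in \<open>auto simp: enc_Pair enc_nat_def\<close>)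
  then show ?thesis using det PrimS(3,4) by metis
next
  case (Mn f)
  from assms(2) have f: "(f, y' # xs, 0) \<in> set D'" "\<And>z. z < y' \<Longrightarrow> \<exists>v>0. (f, z # xs, v) \<in> set D'"
    by (cases rule: justified_cases, use Mn in \<open>auto simp: enc_Pair enc_nat_def\<close>)+
  show ?thesis
  \<comment> \<open>If the two search results differed, the value at the smaller one would be both
    zero and positive.\<close>
  proof (rule linorder_cases [of y y'])
    assume "y < y'"
    then show ?thesis using f(2) [of y] Mn(2) det by fastforce
  next
    assume "y' < y"
    then show ?thesis using Mn(3) [of y'] f(1) det by fastforce
  qed
next
  case Oracle
  from assms(2) show ?thesis by (cases rule: justified_cases) (use Oracle in \<open>auto simp: enc_Pair enc_nat_def\<close>)
qed

text \<open>The induction shortens \<open>D\<close> only; a judgement in \<open>D'\<close> is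
  justified from all of \<open>D'\<close>. The bounds \<open>u\<close> and \<open>u'\<close> are
  independent, so values found with different bounds agree.\<close>

lemma valid_deterministic:
  assumes "valid X u D" "valid X u' D'"
  shows "(c, xs, y) \<in> set D \<Longrightarrow> (c, xs, y') \<in> set D' \<Longrightarrow> y = y'"
  using assms(1)
proof (induction D arbitrary: c xs y y')
  case (Cons j D)
  have "justified X u' D' (c, xs, y')" using valid_justified assms(2) Cons.prems(2) by blast
  then show ?case
    using Cons.IH Cons.prems justified_deterministic [of X u D c xs y u' D' y'] by (metis set_ConsD valid.simps(2))
qed simp

lemma valid_sound:
  assumes "valid X u D" shows "(code c, xs, y) \<in> set D \<Longrightarrow> eval (chi X) c xs y"
  using assms
proof (induction D arbitrary: c xs y)
  case (Cons j D)
  show ?case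
  proof (cases "(code c, xs, y) \<in> set D")
    case True
    then show ?thesis using Cons by simp
  next
    case False
    then have j: "justified X u D (code c, xs, y)" using Cons.prems by auto
    have IH: "(code c, xs, y) \<in> set D \<Longrightarrow> eval (chi X) c xs y" for c xs y
      using Cons.IH Cons.prems by simp
    show ?thesis
    proof (cases c)
      case Zero
      from j show ?thesis
        by (cases rule: justified_cases) (use Zero in \<open>auto simp: enc_Pair enc_nat_def eval_Zero\<close>)
    next
      case Succ
      have "eval (chi X) Succ xs (Suc (head0 xs))"
        using eval_Succ [of "chi X" xs] by (cases xs) (simp_all add: head0_def)
      with j show ?thesis
        by (cases rule: justified_cases) (use Succ in \<open>auto simp: enc_Pair enc_nat_def\<close>)
    next
      case (Proj i)
      from j show ?thesis
        by (cases rule: justified_cases) (use Proj in \<open>auto simp: enc_Pair enc_nat_def eval_Proj\<close>)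
    next
      case (Comp f hs)
      from j obtain ys where "(code f, ys, y) \<in> set D" "list_all2 (\<lambda>h v. (h, xs, v) \<in> set D) (map code hs) ys"
        by (cases rule: justified_cases) (use Comp in \<open>auto simp: enc_Pair enc_nat_def enc_eq_iff\<close>)
      moreover have "list_all2 (\<lambda>h y. eval (chi X) h xs y) hs ys"
        using calculation(2) IH by (auto simp: list_all2_conv_all_nth)
      ultimately show ?thesis unfolding Comp by (intro eval_Comp IH)
    next
      case (Prim f h)
      from j show ?thesis
      proof (cases rule: justified_cases)
        case (Prim0 f' h' xs')
        then show ?thesis using Prim IH by (auto simp: enc_Pair enc_nat_def intro: eval_Prim0)
      next
        case (PrimS f' h' n xs' r)
        then have "f' = code f" "h' = code h" using Prim by (auto simp: enc_Pair enc_nat_def)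
        with PrimS have "eval (chi X) c (n # xs') r" "eval (chi X) h (n # r # xs') y" using IH by auto
        then show ?thesis using PrimS(2) unfolding Prim by (auto intro: eval_PrimS)
      qed (use Prim in \<open>auto simp: enc_Pair enc_nat_def\<close>)
    next
      case (Mn f)
      from j have "(code f, y # xs, 0) \<in> set D" "\<And>z. z < y \<Longrightarrow> \<exists>v>0. (code f, z # xs, v) \<in> set D"
        by (cases rule: justified_cases, use Mn in \<open>auto simp: enc_Pair enc_nat_def\<close>)+
      then show ?thesis unfolding Mn using IH by (blast intro: eval_Mn)
    next
      case Oracle
      have "eval (chi X) Oracle xs (chi X (head0 xs))"
        using eval_Oracle [of "chi X" xs] by (cases xs) (simp_all add: head0_def)
      with j show ?thesis
        by (cases rule: justified_cases) (use Oracle in \<open>auto simp: enc_Pair enc_nat_def\<close>)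
    qed
  qed
qed simp

section \<open>Completeness of derivations\<close>

text \<open>Sets of judgements allow all premises of a rule to be collected in one
  derivation.\<close>

definition derivable :: "nat set \<Rightarrow> judgement set \<Rightarrow> bool" where
  "derivable X J \<longleftrightarrow> (\<exists>u D. valid X u D \<and> J \<subseteq> set D)"

lemma derivable_Un: "derivable X J \<Longrightarrow> derivable X K \<Longrightarrow> derivable X (J \<union> K)"
proof -
  assume "derivable X J" "derivable X K"
  then obtain u D v E where "valid X u D" "J \<subseteq> set D" "valid X v E" "K \<subseteq> set E"
    unfolding derivable_def by blast
  then have "valid X (max u v) (D @ E)" "J \<union> K \<subseteq> set (D @ E)"
    using valid_mono [of X u D "max u v"] valid_mono [of X v E "max u v"] by (auto intro: valid_append)
  then show ?thesis unfolding derivable_def by blast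
qed

lemma derivable_empty: "derivable X {}"
  unfolding derivable_def by (intro exI [of _ "[]"] exI [of _ 0]) simp

lemma derivable_UN: "finite I \<Longrightarrow> (\<And>i. i \<in> I \<Longrightarrow> derivable X (J i)) \<Longrightarrow> derivable X (\<Union>i\<in>I. J i)"
  by (induction I rule: finite_induct) (simp_all add: derivable_empty derivable_Un)

lemma derivable_justified:
  assumes "derivable X J" and "\<And>D. J \<subseteq> set D \<Longrightarrow> \<exists>u. justified X u D j"
  shows "derivable X {j}"
proof -
  obtain u D where D: "valid X u D" "J \<subseteq> set D" using assms(1) unfolding derivable_def by blast
  then obtain v where "justified X v D j" using assms(2) by blast
  with D(1) have "valid X (max u v) (j # D)" by (auto intro: valid_mono justified_mono)
  then show ?thesis unfolding derivable_def by (metis empty_subsetI insert_subset list.set_intros(1))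
qed

text \<open>Each rule has finitely many premises; their derivations are concatenated and the
  conclusion is put on top.\<close>

lemma eval_derivable: "eval (chi X) c xs y \<Longrightarrow> derivable X {(code c, xs, y)}"
proof (induction rule: eval.induct)
  case (eval_Zero xs)
  show ?case by (rule derivable_justified [OF derivable_empty]) (simp add: justified_def just_Zero_def)
next
  case (eval_Succ xs)
  show ?case
    by (rule derivable_justified [OF derivable_empty])
      (cases xs; simp add: justified_def just_Succ_def head0_def)
next
  case (eval_Proj i xs)
  then show ?case
    by (intro derivable_justified [OF derivable_empty]) (simp add: justified_def just_Proj_def hd_drop_conv_nth)
next
  case (eval_Comp xs hs ys f y)
  have len: "length hs = length ys" using list_all2_lengthD [OF eval_Comp.IH(1)] .
  have 1: "derivable X (\<Union>i\<in>{..<length ys}. {(code (hs ! i), xs, ys ! i)})"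
    using eval_Comp.IH(1) by (intro derivable_UN) (auto simp: list_all2_conv_all_nth)
  show ?case
  proof (rule derivable_justified [OF derivable_Un [OF 1 eval_Comp.IH(2)]])
    fix D :: "judgement list"
    assume "(\<Union>i\<in>{..<length ys}. {(code (hs ! i), xs, ys ! i)}) \<union> {(code f, ys, y)} \<subseteq> set D"
    then have "(code f, ys, y) \<in> set D" "\<And>i. i < length ys \<Longrightarrow> (code (hs ! i), xs, ys ! i) \<in> set D"
      by blast+
    then have "just_Comp D (code (Comp f hs)) xs y"
      unfolding just_Comp_def using len
      by (auto simp: hd_drop_conv_nth drop_map hd_map intro!: bexI [of _ "(code f, ys, y)"])
    then show "\<exists>u. justified X u D (code (Comp f hs), xs, y)"
      by (simp add: justified_def)
  qed
next
  case (eval_Prim0 f xs y h)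
  show ?case
    by (rule derivable_justified [OF eval_Prim0.IH]) (auto simp: justified_def just_Prim_def)
next
  case (eval_PrimS f h n xs r y)
  show ?case
    by (rule derivable_justified [OF derivable_Un [OF eval_PrimS.IH]])
      (auto simp: justified_def just_Prim_def Let_def simp del: code.simps(1-3,6-), force)
next
  case (eval_Mn f y xs)
  from eval_Mn.IH(2) obtain v where v: "\<And>z. z < y \<Longrightarrow> v z > 0 \<and> derivable X {(code f, z # xs, v z)}"
    by metis
  have 1: "derivable X (\<Union>z\<in>{..<y}. {(code f, z # xs, v z)})"
    using v by (intro derivable_UN) auto
  show ?case
  proof (rule derivable_justified [OF derivable_Un [OF 1 eval_Mn.IH(1)]])
    fix D :: "judgement list"
    assume "(\<Union>z\<in>{..<y}. {(code f, z # xs, v z)}) \<union> {(code f, y # xs, 0)} \<subseteq> set D"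
    then have "(code f, y # xs, 0) \<in> set D" "\<And>z. z < y \<Longrightarrow> (code f, z # xs, v z) \<in> set D"
      by blast+
    then have "just_Mn D (code (Mn f)) xs y"
      unfolding just_Mn_def using v by (auto intro!: bexI [where x = "(code f, _ # xs, v _)"])
    then show "\<exists>u. justified X u D (code (Mn f), xs, y)"
      by (simp add: justified_def)
  qed
next
  case (eval_Oracle xs)
  have "just_Oracle X (Suc (head0 xs)) (code Oracle) xs (chi X (case xs of [] \<Rightarrow> 0 | x # _ \<Rightarrow> x))"
    by (cases xs) (simp_all add: just_Oracle_def head0_def chi_def)
  then have "justified X (Suc (head0 xs)) D (code Oracle, xs, chi X (case xs of [] \<Rightarrow> 0 | x # _ \<Rightarrow> x))" for D
    by (simp add: justified_def)
  then show ?case by (intro derivable_justified [OF derivable_empty]) blast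
qed

text \<open>Determinism of \<open>eval\<close> is inherited from derivations.\<close>

lemma eval_chi_deterministic: "eval (chi X) c xs y \<Longrightarrow> eval (chi X) c xs z \<Longrightarrow> y = z"
  by (drule eval_derivable)+ (auto simp: derivable_def intro: valid_deterministic)

lemma chi_empty: "chi {} = (\<lambda>_. 0)"
  by (simp add: chi_def fun_eq_iff)

text \<open>The single bound \<open>u\<close> serves both as the use and as the bound on the computation.\<close>

definition converges :: "nat \<Rightarrow> nat set \<Rightarrow> nat \<Rightarrow> nat \<Rightarrow> nat \<Rightarrow> bool" where
  "converges e X u y v \<longleftrightarrow> y < u \<and> v < u \<and> (\<exists>D. enc D < u \<and> valid X u D \<and> (e, [y], v) \<in> set D)"

lemma converges_use:
  assumes "converges e X u y v" "X \<inter> {..<u} = X' \<inter> {..<u}" "u \<le> u'"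
  shows "converges e X' u' y v"
  using assms valid_cong [OF assms(2)] unfolding converges_def
  by (meson order_less_le_trans valid_mono)

lemma converges_mono: "converges e Y u y v \<Longrightarrow> u \<le> u' \<Longrightarrow> converges e Y u' y v"
  by (rule converges_use) simp_all

lemma converges_functional: "converges e X u y v \<Longrightarrow> converges e X u' y v' \<Longrightarrow> v = v'"
  unfolding converges_def using valid_deterministic by blast

lemma eval_converges: "eval (chi X) c [y] v \<Longrightarrow> \<exists>u. converges (code c) X u y v"
proof -
  assume "eval (chi X) c [y] v"
  then obtain u D where D: "valid X u D" "(code c, [y], v) \<in> set D"
    using eval_derivable unfolding derivable_def by blast
  \<comment> \<open>The sum dominates use, derivation, argument and value; the 1 makes the bounds
    strict.\<close>
  have "converges (code c) X (u + enc D + y + v + 1) y v"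
    unfolding converges_def using D valid_mono [OF D(1)] by (auto intro!: exI [of _ D])
  then show ?thesis by blast
qed

lemma converges_complete: "turing_le f (chi X) \<Longrightarrow> \<exists>e. \<forall>y. \<exists>u. converges e X u y (f y)"
  unfolding turing_le_def using eval_converges by blast

lemma converges_sound: "converges (code c) X u y v \<Longrightarrow> eval (chi X) c [y] v"
  unfolding converges_def using valid_sound by blast

section \<open>Decidability of bounded convergence, and c.e. sets by stages\<close>

lemma dec_in_comp2:
  "dec_in g (\<lambda>p. P (fst p) (snd p)) \<Longrightarrow> rec_in g a \<Longrightarrow> rec_in g b \<Longrightarrow> dec_in g (\<lambda>x. P (a x) (b x))"
  by (drule dec_in_comp [where a = "\<lambda>x. (a x, b x)"]) (simp_all add: rec_in_Pair)

text \<open>Replaces recursion over the derivation by a bounded quantifier, to which the closure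
  rules apply.\<close>

lemma valid_iff_nth:
  "valid X u D \<longleftrightarrow> (\<forall>i<length D. justified X u (drop (Suc i) D) (hd (drop i D)))"
  by (induction D) (simp_all add: All_less_Suc2)

lemma dec_in_justified:
  "dec_in g (\<lambda>p. justified (set (fst p)) (fst (snd p)) (fst (snd (snd p))) (snd (snd (snd p))))"
  unfolding justified_def Let_def just_defs head0_def by (intro rec_intros)

lemma dec_in_valid:
  "dec_in g (\<lambda>p. valid (set (fst p)) (fst (snd p)) (snd (snd p)))"
proof -
  have "dec_in g (\<lambda>p. justified (set (fst (fst p))) (fst (snd (fst p)))
      (drop (Suc (snd p)) (snd (snd (fst p)))) (hd (drop (snd p) (snd (snd (fst p))))))"
    using dec_in_comp [OF dec_in_justified, of g "\<lambda>p. (fst (fst p), fst (snd (fst p)),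
      drop (Suc (snd p)) (snd (snd (fst p))), hd (drop (snd p) (snd (snd (fst p)))))"]
    by (simp add: rec_intros)
  then show ?thesis unfolding valid_iff_nth by (intro rec_intros)
qed

text \<open>The inner oracle is a finite list and part of the input, so one decision procedure
  serves all stages of the splitting.\<close>

lemma dec_in_converges [rec_intros]:
  assumes "rec_in g e" "rec_in g L" "rec_in g u" "rec_in g y" "rec_in g v"
  shows "dec_in g (\<lambda>x. converges (e x) (set (L x)) (u x) (y x) (v x))"
proof -
  have "dec_in g (\<lambda>p. valid (set (fst (snd (fst p)))) (fst (snd (snd (fst p)))) (snd p))"
    using dec_in_comp [OF dec_in_valid, of g "\<lambda>p. (fst (snd (fst p)), fst (snd (snd (fst p))), snd p)"]
    by (simp add: rec_intros)
  then have "dec_in g (\<lambda>p. converges (fst p) (set (fst (snd p))) (fst (snd (snd p)))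
      (fst (snd (snd (snd p)))) (snd (snd (snd (snd p)))))"
    unfolding converges_def by (intro rec_intros)
  from dec_in_comp [OF this, of "\<lambda>x. (e x, L x, u x, y x, v x)"] show ?thesis
    using assms by (simp add: rec_intros)
qed

lemma ce_decidable_stages:
  assumes "ce A"
  obtains P :: "nat \<Rightarrow> nat \<Rightarrow> bool" where "\<And>g. dec_in g (\<lambda>p. P (fst p) (snd p))" "\<And>n. n \<in> A \<longleftrightarrow> (\<exists>k. P n k)"
proof -
  obtain c where c: "\<And>n. n \<in> A \<longleftrightarrow> (\<exists>y. eval (chi {}) c [n] y)"
    using assms unfolding ce_def chi_empty by blast
  \<comment> \<open>\<open>set []\<close> is the empty oracle in the form required by
    \<open>dec_in_converges\<close>.\<close>
  define P where "P n k \<longleftrightarrow> (\<exists>v<k. converges (code c) (set []) k n v)" for n k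
  have dec: "dec_in g (\<lambda>p. P (fst p) (snd p))" for g
    unfolding P_def by (intro rec_intros)
  have "\<exists>k. P n k" if "eval (chi {}) c [n] v" for n v
    using eval_converges [OF that] unfolding P_def converges_def by auto
  moreover have "\<exists>v. eval (chi {}) c [n] v" if "P n k" for n k
    using that unfolding P_def by (auto intro: converges_sound)
  ultimately have "n \<in> A \<longleftrightarrow> (\<exists>k. P n k)" for n
    using c by blast
  with dec show thesis by (rule that)
qed

text \<open>Unbounded search for a witness halts exactly on this set; determinism excludes a halt at
  a false witness.\<close>

lemma ce_Collect_ex:
  assumes "dec_in (\<lambda>_. 0) (\<lambda>p. P (fst p) (snd p))"
  shows "ce {n. \<exists>k. P n (k::nat)}"
proof -
  obtain c where c: "\<And>n k. eval (\<lambda>_. 0) c [enc (n::nat, k)] (of_bool (\<not> P n k))"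
    using dec_in_not [OF assms] unfolding dec_in_def rec_in_def enc_nat_def by (metis fst_conv snd_conv)
  obtain cp where cp: "\<And>x y. eval (\<lambda>_. 0) cp [x, y] (prod_encode (x, y))" using program_prod_encode by blast
  define d where "d = Comp c [Comp cp [Proj 1, Proj 0]]"
  have d: "eval (\<lambda>_. 0) d [k, n] (of_bool (\<not> P n k))" for k n
    unfolding d_def by (rule eval_Comp1 [OF _ c]) (auto simp: enc_Pair enc_nat_def intro!: eval_Comp2 [OF _ _ cp] eval_Proj')
  have "(\<exists>k. P n k) \<longleftrightarrow> (\<exists>y. eval (\<lambda>_. 0) (Mn d) [n] y)" for n
  proof
    assume "\<exists>k. P n k"
    then show "\<exists>y. eval (\<lambda>_. 0) (Mn d) [n] y"
      using eval_Mn_Least [of "\<lambda>_. 0" d "[n]", OF d] by auto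
  next
    assume "\<exists>y. eval (\<lambda>_. 0) (Mn d) [n] y"
    then obtain y where "eval (\<lambda>_. 0) d [y, n] 0" by (auto elim: eval_MnE)
    then have "of_bool (\<not> P n y) = (0::nat)"
      using d eval_chi_deterministic [of "{}"] unfolding chi_empty by blast
    then show "\<exists>k. P n k" by auto
  qed
  then show ?thesis unfolding ce_def by blast
qed

text \<open>Transfers a computation with the zero oracle to an arbitrary oracle without changing its
  program: a sufficient bound is searched for first, then the value, and both tests are decidable in
  \<open>g\<close>.\<close>

lemma computable_rec_in:
  assumes "computable f" shows "rec_in g f"
proof -
  obtain e where e: "\<And>y. \<exists>u. converges e {} u y (f y)"
    using assms converges_complete [of f "{}"] unfolding computable_def chi_empty by blast
  have f: "converges e {} u y v \<Longrightarrow> v = f y" for u y v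
    using e converges_functional by blast
  define s where "s y = (LEAST u. \<exists>v<u. converges e (set []) u y v)" for y
  have ex: "\<exists>u. \<exists>v<u. converges e (set []) u y v" for y
    using e [of y] unfolding converges_def by auto
  have s: "rec_in g s"
    unfolding s_def by (rule rec_in_Least [OF _ ex]) (intro rec_intros)
  have sf: "converges e (set []) (s y) y (f y)" for y
    using LeastI_ex [OF ex [of y]] f unfolding s_def by auto
  have "rec_in g (\<lambda>y. LEAST v. converges e (set []) (s y) y v)"
    by (rule rec_in_Least) (intro rec_intros rec_in_comp [OF s], use sf in blast)
  moreover have "(LEAST v. converges e (set []) (s y) y v) = f y" for y
    using sf [of y] by (intro Least_equality) (auto dest: f)
  ultimately show ?thesis by simp
qed

lemma rec_in_chi_iff: "rec_in g (chi D) \<longleftrightarrow> dec_in g (\<lambda>x. x \<in> D)"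
proof -
  have "chi D = (\<lambda>x. of_bool (x \<in> D))" by (simp add: chi_def fun_eq_iff)
  then show ?thesis unfolding dec_in_def by simp
qed

subsection \<open>Sacks splitting\<close>

type_synonym state = "nat list \<times> nat list"

definition part :: "bool \<Rightarrow> state \<Rightarrow> nat list" where
  "part b S = (if b then fst S else snd S)"

text \<open>Requirement \<open>n\<close> concerns the functional with code \<open>index n\<close> and the left half iff \<open>side n\<close>.\<close>

definition index :: "nat \<Rightarrow> nat" where
  "index n = fst (dec n :: nat \<times> nat)"

definition side :: "nat \<Rightarrow> bool" where
  "side n \<longleftrightarrow> snd (dec n :: nat \<times> nat) = 0"

lemma ex_requirement: "\<exists>n. index n = e \<and> side n = b"
  by (intro exI [of _ "enc (e, if b then 0 else 1 :: nat)"]) (simp add: index_def side_def)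

text \<open>
  The c.e. sets are \<open>A = {x. \<exists>k. PA x k}\<close> and \<open>B = {x. \<exists>k. PB x k}\<close>; stage \<open>enc (x, k)\<close> enumerates \<open>x\<close>
  if \<open>PA x k\<close> holds and \<open>x\<close> is new. A new element avoids the half of the strongest requirement that
  restrains it.
\<close>

locale splitting =
  fixes PA PB :: "nat \<Rightarrow> nat \<Rightarrow> bool"
begin

text \<open>Looking like a separator at \<open>y\<close>, as far as stage \<open>s\<close> can tell:
  \<open>A\<close> is approximated by the two halves, \<open>B\<close> by witnesses below
  \<open>s\<close>.\<close>

definition agrees :: "nat \<Rightarrow> state \<Rightarrow> nat \<Rightarrow> nat \<Rightarrow> bool" where
  "agrees n S s y \<longleftrightarrow> (\<exists>v<2. converges (index n) (set (part (side n) S)) s y v \<and>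
     (y \<in> set (fst S) \<or> y \<in> set (snd S) \<longrightarrow> v = 1) \<and> ((\<exists>k<s. PB y k) \<longrightarrow> v = 0))"

text \<open>
  Enumerating \<open>x\<close> leaves the oracle below \<open>x\<close> unchanged, so it endangers a computation only if the
  bound \<open>x\<close> does not suffice for convergence; no use function is needed.
\<close>

definition restrains :: "nat \<Rightarrow> state \<Rightarrow> nat \<Rightarrow> nat \<Rightarrow> bool" where
  "restrains n S s x \<longleftrightarrow> (\<exists>y<s. (\<forall>z<y. agrees n S s z) \<and>
     (\<exists>v<s. converges (index n) (set (part (side n) S)) s y v) \<and>
     \<not> (\<exists>v<x. converges (index n) (set (part (side n) S)) x y v))"

text \<open>Smaller numbers have priority. The bound \<open>n < s\<close> keeps the search finite;
  an element restrained by no requirement below \<open>s\<close> enters the left half.\<close>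

definition avoid_left :: "state \<Rightarrow> nat \<Rightarrow> nat \<Rightarrow> bool" where
  "avoid_left S s x \<longleftrightarrow> (\<exists>n<s. side n \<and> restrains n S s x \<and> (\<forall>m<n. \<not> restrains m S s x))"

definition step :: "nat \<Rightarrow> state \<Rightarrow> state" where
  "step s S = (let x = fst (dec s :: nat \<times> nat); k = snd (dec s :: nat \<times> nat) in
     if PA x k \<and> x \<notin> set (fst S) \<and> x \<notin> set (snd S) then
       if avoid_left S s x then (fst S, x # snd S) else (x # fst S, snd S)
     else S)"

definition state :: "nat \<Rightarrow> state" where
  "state s = rec_nat ([], []) step s"

definition stage :: "bool \<Rightarrow> nat \<Rightarrow> nat set" where
  "stage b s = set (part b (state s))"

definition limit :: "bool \<Rightarrow> nat set" where
  "limit b = (\<Union>s. stage b s)"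

lemma state_Suc: "state (Suc s) = step s (state s)"
  by (simp add: state_def)

lemma stage_0: "stage b 0 = {}"
  by (simp add: stage_def state_def part_def)

lemma stage_Suc: "stage b (Suc s) = (let x = fst (dec s :: nat \<times> nat) in
  if PA x (snd (dec s :: nat \<times> nat)) \<and> x \<notin> stage True s \<and> x \<notin> stage False s
     \<and> b = (\<not> avoid_left (state s) s x)
  then insert x (stage b s) else stage b s)"
  unfolding stage_def state_Suc by (cases b) (simp_all add: step_def part_def Let_def)

lemma stage_mono: "s \<le> t \<Longrightarrow> stage b s \<subseteq> stage b t"
  by (rule lift_Suc_mono_le) (auto simp: stage_Suc Let_def)

lemma stage_subset_limit: "stage b s \<subseteq> limit b"
  by (auto simp: limit_def)

lemma entering_half:
  assumes "x \<in> stage b (Suc s)" "x \<notin> stage b s"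
  shows "b = (\<not> avoid_left (state s) s x)"
  using assms by (auto simp: stage_Suc Let_def split: if_splits)

lemma stage_subset: "stage b s \<subseteq> {x. \<exists>k. PA x k}"
  by (induction s) (auto simp: stage_0 stage_Suc Let_def split: if_splits)

lemma stage_disjoint: "stage True s \<inter> stage False s = {}"
  by (induction s) (auto simp: stage_0 stage_Suc Let_def split: if_splits)

lemma limit_disjoint: "limit True \<inter> limit False = {}"
proof -
  have "x \<notin> stage False t" if "x \<in> stage True s" for x s t
    using stage_disjoint [of "max s t"] stage_mono [of s "max s t" True] stage_mono [of t "max s t" False] that by auto
  then show ?thesis by (auto simp: limit_def)
qed

lemma limit_union: "limit True \<union> limit False = {x. \<exists>k. PA x k}"
proof
  show "limit True \<union> limit False \<subseteq> {x. \<exists>k. PA x k}"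
    using stage_subset unfolding limit_def by blast
  show "{x. \<exists>k. PA x k} \<subseteq> limit True \<union> limit False"
  proof
    fix x assume "x \<in> {x. \<exists>k. PA x k}"
    then obtain k where "PA x k" by blast
    then have "x \<in> stage True (Suc (enc (x, k))) \<union> stage False (Suc (enc (x, k)))"
      by (simp add: stage_Suc Let_def)
    then show "x \<in> limit True \<union> limit False" using stage_subset_limit by blast
  qed
qed

lemma limit_settles: "\<exists>s. \<forall>t\<ge>s. stage b t \<inter> {..<u} = limit b \<inter> {..<u}"
proof (induction u)
  case (Suc u)
  then obtain s where s: "\<And>t. s \<le> t \<Longrightarrow> stage b t \<inter> {..<u} = limit b \<inter> {..<u}" by blast
  obtain s' where s': "u \<in> limit b \<Longrightarrow> u \<in> stage b s'" unfolding limit_def by blast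
  have "stage b t \<inter> {..<Suc u} = limit b \<inter> {..<Suc u}" if "max s s' \<le> t" for t
  proof -
    have "u \<in> stage b t \<longleftrightarrow> u \<in> limit b" using s' stage_mono [of s' t b] stage_subset_limit that by auto
    with s [of t] that show ?thesis by (auto simp: lessThan_Suc)
  qed
  then show ?case by blast
qed simp

lemma limit_converges:
  assumes "converges e (limit b) u y v"
  shows "\<exists>s. \<forall>t\<ge>s. converges e (stage b t) u y v"
proof -
  obtain s where "\<And>t. s \<le> t \<Longrightarrow> stage b t \<inter> {..<u} = limit b \<inter> {..<u}" using limit_settles by blast
  then show ?thesis using converges_use [OF assms] by (metis order_refl)
qed

lemma converges_limit:
  assumes "\<forall>t\<ge>s. converges e (stage b t) u y v"
  shows "converges e (limit b) u y v"
proof -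
  obtain s' where s': "\<And>t. s' \<le> t \<Longrightarrow> stage b t \<inter> {..<u} = limit b \<inter> {..<u}" using limit_settles by blast
  have "converges e (stage b (max s s')) u y v" using assms by simp
  then show ?thesis by (rule converges_use [OF _ s' order_refl]) simp
qed

lemma agrees_iff: "agrees n (state s) s y \<longleftrightarrow> (\<exists>v<2. converges (index n) (stage (side n) s) s y v \<and>
     (y \<in> stage True s \<union> stage False s \<longrightarrow> v = 1) \<and> ((\<exists>k<s. PB y k) \<longrightarrow> v = 0))"
  by (simp add: agrees_def stage_def part_def)

text \<open>The bounds in \<open>restrains_def\<close> are there for decidability;
  \<open>converges\<close> implies them.\<close>

lemma restrains_iff: "restrains n (state s) s x \<longleftrightarrow> (\<exists>y. (\<forall>z<y. agrees n (state s) s z) \<and>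
     (\<exists>v. converges (index n) (stage (side n) s) s y v) \<and>
     \<not> (\<exists>v. converges (index n) (stage (side n) s) x y v))"
  unfolding restrains_def stage_def by (meson converges_def)

text \<open>A bound \<open>x\<close> of at least \<open>s\<close> suffices for every computation
  seen at stage \<open>s\<close>.\<close>

lemma restrains_less: "restrains n (state s) s x \<Longrightarrow> x < s"
  unfolding restrains_iff using converges_mono not_less by blast

section \<open>Finite injury and preservation of computations\<close>

text \<open>From stage \<open>s0\<close> on, requirement \<open>n\<close> is never injured.\<close>

definition settled :: "nat \<Rightarrow> nat \<Rightarrow> bool" where
  "settled n s0 \<longleftrightarrow> (\<forall>s\<ge>s0. \<forall>x.
     x \<in> stage (side n) (Suc s) \<longrightarrow> x \<notin> stage (side n) s \<longrightarrow> \<not> restrains n (state s) s x)"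

definition restraint_bounded :: "nat \<Rightarrow> bool" where
  "restraint_bounded n \<longleftrightarrow> (\<exists>R. \<forall>s x. restrains n (state s) s x \<longrightarrow> x < R)"

text \<open>Once both halves are final below the restraints of all stronger requirements, no
  stronger requirement restrains an entering element. If \<open>n\<close> restrains it, then
  \<open>n\<close> decides which half it avoids.\<close>

lemma ex_settled:
  assumes "\<And>m. m < n \<Longrightarrow> restraint_bounded m"
  shows "\<exists>s0. settled n s0"
proof -
  obtain R where R: "\<And>m s x. m < n \<Longrightarrow> restrains m (state s) s x \<Longrightarrow> x < R m"
    using assms unfolding restraint_bounded_def by metis
  define M where "M = (\<Sum>m<n. R m)"
  have M: "x < M" if "m < n" "restrains m (state s) s x" for m s x
    using R [OF that] member_le_sum [of m "{..<n}" R] that(1) unfolding M_def by auto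
  obtain s1 where s1: "\<And>b t. s1 \<le> t \<Longrightarrow> stage b t \<inter> {..<M} = limit b \<inter> {..<M}"
  proof -
    obtain s s' where "\<And>t. s \<le> t \<Longrightarrow> stage True t \<inter> {..<M} = limit True \<inter> {..<M}"
      "\<And>t. s' \<le> t \<Longrightarrow> stage False t \<inter> {..<M} = limit False \<inter> {..<M}" using limit_settles by metis
    then have "max s s' \<le> t \<Longrightarrow> stage b t \<inter> {..<M} = limit b \<inter> {..<M}" for b t by (cases b) auto
    then show thesis by (rule that)
  qed
  \<comment> \<open>\<open>Suc n\<close> makes \<open>n\<close> smaller than the stage, as
    \<open>avoid_left\<close> demands.\<close>
  have "settled n (max s1 (Suc n))" unfolding settled_def
  proof (intro allI impI notI)
    fix s x assume s: "max s1 (Suc n) \<le> s" and x: "x \<in> stage (side n) (Suc s)" "x \<notin> stage (side n) s"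
      and r: "restrains n (state s) s x"
    have "\<not> x < M" using s1 [of s "side n"] s1 [of "Suc s" "side n"] s x by auto
    then have m: "\<not> restrains m (state s) s x" if "m < n" for m using M that by blast
    have "avoid_left (state s) s x \<longleftrightarrow> side n"
    proof
      assume "avoid_left (state s) s x"
      then obtain n' where "side n'" "restrains n' (state s) s x" "\<forall>m<n'. \<not> restrains m (state s) s x"
        unfolding avoid_left_def by blast
      moreover then have "n' = n" using m r by (meson linorder_neqE_nat)
      ultimately show "side n" by simp
    next
      assume "side n"
      then show "avoid_left (state s) s x" unfolding avoid_left_def using m r s by (intro exI [of _ n]) auto
    qed
    then show False using entering_half [OF x] by simp
  qed
  then show ?thesis by blast
qed

text \<open>Consider the least bound \<open>u'\<close> at which the computation converges. An
  element below \<open>u'\<close> that entered the oracle would be restrained, since no bound below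
  \<open>u'\<close> suffices and all arguments before \<open>y\<close> agree; \<open>settled\<close>
  rules this out.\<close>

lemma computation_persists:
  assumes settled: "settled n s0" and s: "s0 \<le> s" "u \<le> s"
    and ok: "\<And>t z. s \<le> t \<Longrightarrow> z < y \<Longrightarrow> agrees n (state t) t z"
    and conv: "converges (index n) (stage (side n) s) u y v"
  obtains u' where "u' \<le> u" "\<And>t. s \<le> t \<Longrightarrow> converges (index n) (stage (side n) t) u' y v"
proof -
  let ?C = "\<lambda>t u v. converges (index n) (stage (side n) t) u y v"
  define u' where "u' = (LEAST u'. \<exists>v'. ?C s u' v')"
  have u': "u' \<le> u" unfolding u'_def by (rule Least_le) (use conv in blast)
  have "\<exists>v'. ?C s u' v'" unfolding u'_def by (rule LeastI [of _ u]) (use conv in blast)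
  then have c: "?C s u' v" using conv converges_functional by blast
  have least: "\<not> ?C s w v'" if "w < u'" for w v' using not_less_Least that unfolding u'_def by blast
  \<comment> \<open>Minimality of \<open>u'\<close> is carried along, since the restraint at the
    next stage depends on it.\<close>
  have "?C t u' v \<and> (\<forall>w<u'. \<forall>v'. \<not> ?C t w v')" if "s \<le> t" for t
    using that
  proof (induction t rule: dec_induct)
    case base
    show ?case using c least by blast
  next
    case (step t)
    have eq: "stage (side n) t \<inter> {..<u'} = stage (side n) (Suc t) \<inter> {..<u'}"
    proof (rule ccontr)
      assume "\<not> ?thesis"
      then obtain x where x: "x < u'" "x \<in> stage (side n) (Suc t)" "x \<notin> stage (side n) t"
        using stage_mono [of t "Suc t" "side n"] by auto
      then have "\<not> restrains n (state t) t x" using settled s(1) step.hyps unfolding settled_def by simp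
      moreover have "?C t t v" using step.IH u' s(2) step.hyps by (auto intro: converges_mono)
      ultimately have "\<exists>v'. ?C t x v'" using ok step.hyps unfolding restrains_iff by blast
      then show False using step.IH x(1) by blast
    qed
    have "\<not> ?C (Suc t) w v'" if "w < u'" for w v'
    proof
      assume "?C (Suc t) w v'"
      moreover have "stage (side n) (Suc t) \<inter> {..<w} = stage (side n) t \<inter> {..<w}"
        using eq that by (force simp: set_eq_iff)
      ultimately show False using step.IH that converges_use [OF _ _ order_refl] by blast
    qed
    then show ?case using converges_use [OF _ eq order_refl] step.IH by blast
  qed
  then show thesis using that u' by blast
qed

lemma eventually_all_below:
  assumes "\<And>z. z < y \<Longrightarrow> \<exists>s. \<forall>t\<ge>s. P t z"
  shows "\<exists>s\<ge>s0. \<forall>t\<ge>s. \<forall>z<y. P (t::nat) (z::nat)"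
  using assms
proof (induction y)
  case (Suc y)
  then obtain s s' where "s \<ge> s0" "\<forall>t\<ge>s. \<forall>z<y. P t z" "\<forall>t\<ge>s'. P t y" by (metis less_Suc_eq)
  then show ?case by (intro exI [of _ "max s s'"]) (auto simp: less_Suc_eq)
qed auto

section \<open>Effectiveness of the construction\<close>

lemma dec_in_agrees:
  assumes "\<And>g. dec_in g (\<lambda>p. PB (fst p) (snd p))"
    and "rec_in g n" "rec_in g S" "rec_in g s" "rec_in g y"
  shows "dec_in g (\<lambda>x. agrees (n x) (S x) (s x) (y x))"
proof -
  have "dec_in g (\<lambda>p. agrees (fst p) (fst (snd p)) (fst (snd (snd p))) (snd (snd (snd p))))"
    unfolding agrees_def part_def index_def side_def by (intro rec_intros dec_in_comp2 [OF assms(1)])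
  from dec_in_comp [OF this, of "\<lambda>x. (n x, S x, s x, y x)"] show ?thesis
    using assms(2-) by (simp add: rec_intros)
qed

lemma dec_in_restrains:
  assumes "\<And>g. dec_in g (\<lambda>p. PB (fst p) (snd p))"
    and "rec_in g n" "rec_in g S" "rec_in g s" "rec_in g x"
  shows "dec_in g (\<lambda>p. restrains (n p) (S p) (s p) (x p))"
proof -
  have "dec_in g (\<lambda>p. restrains (fst p) (fst (snd p)) (fst (snd (snd p))) (snd (snd (snd p))))"
    unfolding restrains_def part_def index_def side_def by (intro rec_intros dec_in_agrees [OF assms(1)])
  from dec_in_comp [OF this, of "\<lambda>p. (n p, S p, s p, x p)"] show ?thesis
    using assms(2-) by (simp add: rec_intros)
qed

lemma rec_in_state:
  assumes "\<And>g. dec_in g (\<lambda>p. PA (fst p) (snd p))" "\<And>g. dec_in g (\<lambda>p. PB (fst p) (snd p))"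
    and "rec_in g s"
  shows "rec_in g (\<lambda>x. state (s x))"
proof -
  have "rec_in g (\<lambda>p. step (fst p) (snd p))"
    unfolding step_def avoid_left_def side_def Let_def
    by (intro rec_intros dec_in_restrains [OF assms(2)] dec_in_comp2 [OF assms(1)])
  then have "rec_in g (\<lambda>p. step (fst (snd p)) (snd (snd p)))"
    using rec_in_comp [of g _ snd] by (simp add: rec_intros)
  then show ?thesis unfolding state_def using assms(3) by (intro rec_in_rec_nat rec_in_const)
qed

lemma ce_limit:
  assumes "\<And>g. dec_in g (\<lambda>p. PA (fst p) (snd p))" "\<And>g. dec_in g (\<lambda>p. PB (fst p) (snd p))"
  shows "ce (limit b)"
proof -
  have "dec_in (\<lambda>_. 0) (\<lambda>p. fst p \<in> set (part b (state (snd p))))"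
    unfolding part_def by (intro rec_intros rec_in_state assms)
  from ce_Collect_ex [OF this] show ?thesis
    by (simp add: limit_def stage_def UNION_eq)
qed

text \<open>To decide \<open>D\<close> at \<open>y\<close>, wait for a stage after \<open>s0\<close>
  at which all arguments up to \<open>y\<close> agree. The computations seen there are never
  destroyed, so they already give the true values, although the oracle is only a finite
  stage.\<close>

lemma separator_computable:
  assumes PA: "\<And>g. dec_in g (\<lambda>p. PA (fst p) (snd p))" and PB: "\<And>g. dec_in g (\<lambda>p. PB (fst p) (snd p))"
    and settled: "settled n s0"
    and A: "{x. \<exists>k. PA x k} \<subseteq> D" and B: "{x. \<exists>k. PB x k} \<inter> D = {}"
    and D: "\<And>y. \<exists>u. converges (index n) (limit (side n)) u y (chi D y)"
  shows "computable (chi D)"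
proof -
  let ?C = "\<lambda>t u y v. converges (index n) (stage (side n) t) u y v"
  have true: "\<exists>s. \<forall>t\<ge>s. ?C t t y (chi D y)" for y
  proof -
    obtain u s where "\<forall>t\<ge>s. ?C t u y (chi D y)" using D limit_converges by blast
    then show ?thesis by (intro exI [of _ "max s u"]) (auto intro: converges_mono)
  qed
  have ok: "agrees n (state t) t y" if "?C t t y (chi D y)" for t y
  proof -
    have "stage True t \<union> stage False t \<subseteq> D" using stage_subset A by blast
    then show ?thesis unfolding agrees_iff using that B by (intro exI [of _ "chi D y"]) (auto simp: chi_def)
  qed
  \<comment> \<open>Strong induction: correct values before \<open>y\<close> keep agreeing, which
    protects the computation at \<open>y\<close>. Being permanent, it must have the value that the
    limit computation shows.\<close>
  have preserved: "?C t t y (chi D y)" if "s0 \<le> s" "\<forall>z\<le>y. agrees n (state s) s z" "s \<le> t" for s t y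
    using that
  proof (induction y arbitrary: t rule: less_induct)
    case (less y)
    obtain v where "?C s s y v" using less.prems(2) agrees_iff by blast
    moreover have "agrees n (state t) t z" if "s \<le> t" "z < y" for t z
      using that less.prems by (intro ok less.IH) auto
    ultimately obtain u where u: "u \<le> s" "\<And>t. s \<le> t \<Longrightarrow> ?C t u y v"
      using computation_persists [OF settled less.prems(1) order_refl] by blast
    obtain t' where t': "\<And>t. t' \<le> t \<Longrightarrow> ?C t t y (chi D y)" using true by blast
    have "v = chi D y"
      using u(2) [of "max s t'"] t' [of "max s t'"] converges_functional by simp
    then show ?case using u less.prems(3) by (auto intro: converges_mono)
  qed
  \<comment> \<open>The search succeeds because every true computation eventually appears and
    agrees.\<close>
  have ex: "\<exists>s. s0 \<le> s \<and> (\<forall>z<Suc y. agrees n (state s) s z)" for y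
  proof -
    have "\<exists>s. \<forall>t\<ge>s. agrees n (state t) t z" for z using true ok by meson
    then show ?thesis using eventually_all_below [of "Suc y" "\<lambda>t z. agrees n (state t) t z" s0] by blast
  qed
  define \<sigma> where "\<sigma> y = (LEAST s. s0 \<le> s \<and> (\<forall>z<Suc y. agrees n (state s) s z))" for y
  have "s0 \<le> \<sigma> y \<and> (\<forall>z<Suc y. agrees n (state (\<sigma> y)) (\<sigma> y) z)" for y
    unfolding \<sigma>_def by (rule LeastI_ex [OF ex])
  then have \<sigma>_conv: "?C (\<sigma> y) (\<sigma> y) y (chi D y)" for y
    using preserved [of "\<sigma> y" y "\<sigma> y"] by (simp add: less_Suc_eq_le)
  have "y \<in> D \<longleftrightarrow> ?C (\<sigma> y) (\<sigma> y) y 1" for y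
  proof
    show "?C (\<sigma> y) (\<sigma> y) y 1" if "y \<in> D"
      using \<sigma>_conv [of y] that by (simp add: chi_def)
    show "y \<in> D" if "?C (\<sigma> y) (\<sigma> y) y 1"
      using converges_functional [OF \<sigma>_conv that] by (simp add: chi_def split: if_splits)
  qed
  moreover have \<sigma>: "rec_in (\<lambda>_. 0) \<sigma>"
    unfolding \<sigma>_def
    by (rule rec_in_Least [OF _ ex]) (intro rec_intros dec_in_agrees [OF PB] rec_in_state [OF PA PB])
  have "dec_in (\<lambda>_. 0) (\<lambda>y. ?C (\<sigma> y) (\<sigma> y) y 1)"
    unfolding stage_def part_def by (intro rec_intros rec_in_state [OF PA PB] \<sigma>)
  ultimately show ?thesis
    unfolding computable_def rec_in_iff_turing_le [symmetric] rec_in_chi_iff by simp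
qed

text \<open>The value is an explicit argument, so that values agreeing everywhere can be chosen and
  made into a separator.\<close>

definition agrees_in_limit :: "nat \<Rightarrow> nat \<Rightarrow> nat \<Rightarrow> bool" where
  "agrees_in_limit n y v \<longleftrightarrow> v < 2 \<and> (\<exists>u. converges (index n) (limit (side n)) u y v) \<and>
     ((\<exists>k. PA y k) \<longrightarrow> v = 1) \<and> ((\<exists>k. PB y k) \<longrightarrow> v = 0)"

text \<open>Let \<open>y\<close> be the least disagreement. The computations before \<open>y\<close>
  become final with bounds at most \<open>U\<close>. Restraint on behalf of arguments beyond
  \<open>y\<close> ends once \<open>agrees\<close> fails at \<open>y\<close>, and a late computation
  at \<open>y\<close> itself is permanent with bound \<open>u1\<close>.\<close>

lemma restraint_bounded_of_disagreement:
  assumes settled: "settled n s0" and ex: "\<exists>y. \<forall>v. \<not> agrees_in_limit n y v"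
  shows "restraint_bounded n"
proof -
  let ?C = "\<lambda>t u y v. converges (index n) (stage (side n) t) u y v"
  define y where "y = (LEAST y. \<forall>v. \<not> agrees_in_limit n y v)"
  have y: "\<not> agrees_in_limit n y v" for v unfolding y_def using LeastI_ex [OF ex] by blast
  have "\<exists>v. agrees_in_limit n z v" if "z < y" for z
    using not_less_Least [OF that [unfolded y_def]] by blast
  then obtain v where v: "agrees_in_limit n z (v z)" if "z < y" for z by metis
  have "\<exists>u. converges (index n) (limit (side n)) u z (v z)" if "z < y" for z
    using v [OF that] unfolding agrees_in_limit_def by blast
  then obtain u where u: "converges (index n) (limit (side n)) (u z) z (v z)" if "z < y" for z by metis
  define U where "U = (\<Sum>z<y. u z)"
  have U: "u z \<le> U" if "z < y" for z
    unfolding U_def using member_le_sum [of z "{..<y}" u] that by auto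
  obtain s1 where s1: "s1 \<ge> max s0 U" "\<And>t z. s1 \<le> t \<Longrightarrow> z < y \<Longrightarrow> ?C t (u z) z (v z)"
  proof -
    have "\<exists>s. \<forall>t\<ge>s. ?C t (u z) z (v z)" if "z < y" for z
      using u [OF that] by (rule limit_converges)
    then show thesis using that eventually_all_below [of y "\<lambda>t z. ?C t (u z) z (v z)" "max s0 U"] by blast
  qed
  have ok: "agrees n (state t) t z" if "s1 \<le> t" "z < y" for t z
  proof -
    have "?C t t z (v z)" using converges_mono [OF s1(2) [OF that]] s1(1) that(1) U [OF that(2)] by simp
    moreover have "agrees_in_limit n z (v z)" using v that(2) .
    moreover have "stage True t \<union> stage False t \<subseteq> {x. \<exists>k. PA x k}" using stage_subset by blast
    ultimately show ?thesis unfolding agrees_iff agrees_in_limit_def by (intro exI [of _ "v z"]) auto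
  qed
  \<comment> \<open>Either \<open>y\<close> shows no convergence from \<open>s1\<close> on, and
    \<open>u1\<close> is arbitrary, or the first computation found persists and its value eventually
    ceases to look like that of a separator.\<close>
  obtain t1 u1 where t1: "s1 \<le> t1" "\<And>t. t1 \<le> t \<Longrightarrow> \<not> agrees n (state t) t y"
    "\<And>t w. t1 \<le> t \<Longrightarrow> ?C t t y w \<Longrightarrow> \<exists>w. ?C t u1 y w"
  proof (cases "\<exists>t\<ge>s1. \<exists>w. ?C t t y w")
    case False
    then show thesis by (intro that [of s1]) (auto simp: agrees_iff)
  next
    case True
    then obtain t w where t: "s1 \<le> t" "?C t t y w" by blast
    then obtain u1 where u1: "u1 \<le> t" "\<And>t'. t \<le> t' \<Longrightarrow> ?C t' u1 y w"
      using computation_persists [OF settled _ order_refl, of t y w] s1(1) ok by auto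
    then have limit: "converges (index n) (limit (side n)) u1 y w" by (intro converges_limit) blast
    \<comment> \<open>If \<open>y\<close> belongs to \<open>A\<close> or \<open>B\<close>, then this
      is visible by stage \<open>a\<close> or \<open>Suc k\<close>, respectively.\<close>
    obtain a where a: "(\<exists>k. PA y k) \<Longrightarrow> y \<in> stage True a \<union> stage False a"
      using limit_union unfolding limit_def by blast
    obtain k where k: "(\<exists>k. PB y k) \<Longrightarrow> PB y k" by blast
    have "\<not> agrees n (state t') t' y" if t': "max t (max a (Suc k)) \<le> t'" for t'
    proof
      assume "agrees n (state t') t' y"
      then obtain w' where w': "w' < 2" "?C t' t' y w'" "y \<in> stage True t' \<union> stage False t' \<Longrightarrow> w' = 1"
        "(\<exists>k<t'. PB y k) \<Longrightarrow> w' = 0" unfolding agrees_iff by blast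
      have "w' = w" using w'(2) u1(2) [of t'] t' converges_functional by simp
      moreover have "stage True a \<union> stage False a \<subseteq> stage True t' \<union> stage False t'"
        using stage_mono [of a t' True] stage_mono [of a t' False] t' by auto
      moreover have "(\<exists>k. PB y k) \<Longrightarrow> \<exists>k<t'. PB y k" using k t' by (meson Suc_le_lessD max.bounded_iff)
      ultimately have "agrees_in_limit n y w" unfolding agrees_in_limit_def using w' limit a by blast
      then show False using y by blast
    qed
    then show thesis using t(1) u1 by (intro that [of "max t (max a (Suc k))" u1]) auto
  qed
  show ?thesis unfolding restraint_bounded_def
  proof (intro exI allI impI)
    fix s x assume r: "restrains n (state s) s x"
    show "x < Suc (max t1 (max u1 U))"
    proof (cases "s < t1")
      case True
      then show ?thesis using restrains_less [OF r] by simp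
    next
      case False
      obtain y' w where y': "\<forall>z<y'. agrees n (state s) s z" "?C s s y' w" "\<And>v. \<not> ?C s x y' v"
        using r unfolding restrains_iff by blast
      have less: "x < u'" if "?C s u' y' v'" for u' v'
        using y'(3) converges_mono [OF that] not_less by blast
      \<comment> \<open>\<open>y'\<close> is the argument on whose behalf \<open>x\<close> is
        restrained.\<close>
      consider "y' < y" | "y' = y" | "y < y'" by linarith
      then show ?thesis
      proof cases
        case 1
        then have "x < u y'" using s1(2) [of s y'] t1(1) False by (intro less) auto
        then show ?thesis using U [OF 1] by simp
      next
        case 2
        then have "x < u1" using t1(3) [of s w] y'(2) False less by auto
        then show ?thesis by simp
      next
        case 3
        then show ?thesis using y'(1) t1(2) False by auto
      qed
    qed
  qed
qed

text \<open>Strong induction on priority bounds every restraint: agreement everywhere in the limit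
  would yield a computable separator. Then every requirement settles, and a reduction to
  \<open>limit b\<close> would make \<open>D\<close> computable.\<close>

lemma limit_computes_no_separator:
  assumes PA: "\<And>g. dec_in g (\<lambda>p. PA (fst p) (snd p))" and PB: "\<And>g. dec_in g (\<lambda>p. PB (fst p) (snd p))"
    and inseparable: "\<And>D. {x. \<exists>k. PA x k} \<subseteq> D \<Longrightarrow> {x. \<exists>k. PB x k} \<inter> D = {} \<Longrightarrow> \<not> computable (chi D)"
    and A: "{x. \<exists>k. PA x k} \<subseteq> D" and B: "{x. \<exists>k. PB x k} \<inter> D = {}"
  shows "\<not> turing_le (chi D) (chi (limit b))"
proof
  have restraint_bounded: "restraint_bounded n" for n
  proof (induction n rule: less_induct)
    case (less n)
    then obtain s0 where s0: "settled n s0" using ex_settled by blast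
    show ?case
    proof (rule restraint_bounded_of_disagreement [OF s0], rule ccontr)
      assume "\<nexists>y. \<forall>v. \<not> agrees_in_limit n y v"
      then obtain v where v: "\<And>y. agrees_in_limit n y (v y)" by metis
      \<comment> \<open>All values are below 2, so they form the characteristic function of
        \<open>E\<close>.\<close>
      define E where "E = {y. v y = 1}"
      have "v y = chi E y" for y using v [of y] by (auto simp: agrees_in_limit_def E_def chi_def)
      then have "\<exists>u. converges (index n) (limit (side n)) u y (chi E y)" for y
        using v unfolding agrees_in_limit_def by metis
      moreover have "v x = 1" if "PA x k" for x k
        using v [of x] that unfolding agrees_in_limit_def by blast
      moreover have "v x = 0" if "PB x k" for x k
        using v [of x] that unfolding agrees_in_limit_def by blast
      then have "{x. \<exists>k. PB x k} \<inter> E = {}" unfolding E_def by fastforce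
      ultimately have "\<And>y. \<exists>u. converges (index n) (limit (side n)) u y (chi E y)"
        "{x. \<exists>k. PA x k} \<subseteq> E" "{x. \<exists>k. PB x k} \<inter> E = {}"
        unfolding E_def by auto
      then show False using separator_computable [OF PA PB s0] inseparable by blast
    qed
  qed
  assume "turing_le (chi D) (chi (limit b))"
  then obtain e where e: "\<And>y. \<exists>u. converges e (limit b) u y (chi D y)" using converges_complete by blast
  obtain n where n: "index n = e" "side n = b" using ex_requirement by blast
  obtain s0 where s0: "settled n s0" using ex_settled restraint_bounded by blast
  have "computable (chi D)" by (rule separator_computable [OF PA PB s0 A B]) (simp add: n e)
  with inseparable [OF A B] show False by blast
qed

end

section \<open>The splitting theorem and the strictly smaller problem\<close>

theorem sacks_splitting_separators:
  assumes "ce A" "ce B"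
    and inseparable: "\<And>D. A \<subseteq> D \<Longrightarrow> B \<inter> D = {} \<Longrightarrow> \<not> computable (chi D)"
  obtains A0 A1 where "ce A0" "ce A1" "A0 \<union> A1 = A" "A0 \<inter> A1 = {}"
    "\<And>D. A \<subseteq> D \<Longrightarrow> B \<inter> D = {} \<Longrightarrow> \<not> turing_le (chi D) (chi A0)"
    "\<And>D. A \<subseteq> D \<Longrightarrow> B \<inter> D = {} \<Longrightarrow> \<not> turing_le (chi D) (chi A1)"
proof -
  obtain PA :: "nat \<Rightarrow> nat \<Rightarrow> bool" where PA: "\<And>g. dec_in g (\<lambda>p. PA (fst p) (snd p))" "\<And>n. n \<in> A \<longleftrightarrow> (\<exists>k. PA n k)"
    using ce_decidable_stages [OF assms(1)] by blast
  obtain PB :: "nat \<Rightarrow> nat \<Rightarrow> bool" where PB: "\<And>g. dec_in g (\<lambda>p. PB (fst p) (snd p))" "\<And>n. n \<in> B \<longleftrightarrow> (\<exists>k. PB n k)"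
    using ce_decidable_stages [OF assms(2)] by blast
  interpret splitting PA PB .
  have A: "A = {x. \<exists>k. PA x k}" and B: "B = {x. \<exists>k. PB x k}" using PA(2) PB(2) by auto
  have "\<not> turing_le (chi D) (chi (limit b))" if "A \<subseteq> D" "B \<inter> D = {}" for b D
    using limit_computes_no_separator [OF PA(1) PB(1)] inseparable that unfolding A B by blast
  then show thesis
    using that [of "limit True" "limit False"] ce_limit [OF PA(1) PB(1)] limit_union limit_disjoint unfolding A by blast
qed

lemma turing_le_refl: "turing_le f f"
  using rec_in_oracle [OF rec_in_id, of f] by (simp add: rec_in_iff_turing_le)

theorem theorem6:
  assumes "is_sep_problem P" and "unsolvable P"
  shows "\<exists>Q. is_sep_problem Q \<and> unsolvable Q \<and> weak_le Q P \<and> \<not> weak_le P Q"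
proof -
  obtain A B where AB: "ce A" "ce B" "A \<inter> B = {}" and P: "P = sep_problem A B"
    using assms(1) unfolding is_sep_problem_def by blast
  have "\<not> computable (chi D)" if "A \<subseteq> D" "B \<inter> D = {}" for D
    using assms(2) that unfolding P unsolvable_def sep_problem_def by blast
  then obtain A0 A1 where ce: "ce A0" "ce A1" and A: "A0 \<union> A1 = A"
    and A0: "\<And>D. A \<subseteq> D \<Longrightarrow> B \<inter> D = {} \<Longrightarrow> \<not> turing_le (chi D) (chi A0)"
    and A1: "\<And>D. A \<subseteq> D \<Longrightarrow> B \<inter> D = {} \<Longrightarrow> \<not> turing_le (chi D) (chi A1)"
    using sacks_splitting_separators [OF AB(1,2)] by metis
  have "is_sep_problem (sep_problem A0 B)"
    unfolding is_sep_problem_def using ce(1) AB(2,3) A by blast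
  moreover have "unsolvable (sep_problem A0 B)"
    unfolding unsolvable_def
  proof
    assume "\<exists>f\<in>sep_problem A0 B. computable f"
    then obtain D where D: "A0 \<subseteq> D" "B \<inter> D = {}" "computable (chi D)"
      unfolding sep_problem_def by blast
    \<comment> \<open>The algorithm for \<open>D\<close> is moved to the oracle
      \<open>chi A1\<close>, which answers the second disjunct directly.\<close>
    have "dec_in (chi A1) (\<lambda>x. x \<in> D \<or> x \<in> A1)"
      using computable_rec_in [OF D(3)] rec_in_oracle [OF rec_in_id, of "chi A1"]
      unfolding rec_in_chi_iff by (intro dec_in_disj)
    then have "turing_le (chi (D \<union> A1)) (chi A1)"
      unfolding rec_in_iff_turing_le [symmetric] rec_in_chi_iff by simp
    then show False using A1 [of "D \<union> A1"] D A AB(3) by blast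
  qed
  moreover have "weak_le (sep_problem A0 B) P"
    unfolding weak_le_def P sep_problem_def using A turing_le_refl by blast
  moreover have "\<not> weak_le P (sep_problem A0 B)"
  proof
    assume "weak_le P (sep_problem A0 B)"
    moreover have "chi A0 \<in> sep_problem A0 B" unfolding sep_problem_def using A AB(3) by blast
    ultimately show False unfolding weak_le_def P sep_problem_def using A0 by blast
  qed
  ultimately show ?thesis by blast
qed

end
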